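(* Let $F$ be a field, let $A$ be a finitely generated torsion-free abelian group, and let $\mathcal A = F \ast A$ be a twisted group algebra of $A$ over $F$. Let $B$ be a subgroup of $A$ such that $A/B$ is infinite cyclic, and let $\mathcal B = F \ast B \subseteq \mathcal A$. Suppose that $\dim(\mathcal A) = 1$. Then the following holds: if a simple $\mathcal A$-module $U$ is finitely generated as a $\mathcal B$-module, then $U$ is not $\mathcal B$-torsion.
   Context: A twisted group algebra $F \ast A$ of a finitely generated torsion-free abelian group $A$ over a field $F$ is an associative $A$-graded algebra $\bigoplus_{a \in A} F\bar a$ (so $\{\bar a : a \in A\}$ is an $F$-basis) with multiplication $\bar a_1 \bar a_2 = \lambda(a_1,a_2)\overline{a_1a_2}$, where $\lambda : A \times A \to F^* = F\setminus\{0\}$ satisfies the 2-cocycle condition $\lambda(a_1,a_2)\lambda(a_1a_2,a_3) = \lambda(a_2,a_3)\lambda(a_1,a_2a_3)$ for all $a_1,a_2,a_3 \in A$. For a subgroup $B \le A$, $F \ast B = \bigoplus_{b\in B} F\bar b$ is the subalgebra of elements supported in $B$. Modules are right modules. $\dim(\mathcal A)$ denotes the global dimension of $\mathcal A = F\ast A$, which (by a known theorem of Brookes) equals its Krull dimension (in the sense of noncommutative noetherian rings) and equals the supremum of the ranks of subgroups $C \le A$ such that $F \ast C$ is commutative. $S = \mathcal B \setminus\{0\}$ is an Ore set (in $\mathcal B$, which is a domain, and in $\mathcal A$). A module is $\mathcal B$-torsion if each of its elements is annihilated by some element of $\mathcal B\setminus\{0\}$. *)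

theory Defs
  imports "HOL-Algebra.Algebra" "HOL-Library.Poly_Mapping" "HOL-Library.Extended_Nat"
begin

section \<open>Groups\<close>

definition finitely_generated_group :: "('a, 'c) monoid_scheme \<Rightarrow> bool" where
  "finitely_generated_group G \<longleftrightarrow>
     (\<exists>S. finite S \<and> S \<subseteq> carrier G \<and> generate G S = carrier G)"

definition torsion_free_group :: "('a, 'c) monoid_scheme \<Rightarrow> bool" where
  "torsion_free_group G \<longleftrightarrow>
     (\<forall>x\<in>carrier G. \<forall>n>0. x [^]\<^bsub>G\<^esub> (n::nat) = \<one>\<^bsub>G\<^esub> \<longrightarrow> x = \<one>\<^bsub>G\<^esub>)"


section \<open>Twisted group algebras\<close>

definition two_cocycle ::
    "('a, 'c) monoid_scheme \<Rightarrow> ('a \<Rightarrow> 'a \<Rightarrow> 'k::field) \<Rightarrow> bool" where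
  "two_cocycle G lam \<longleftrightarrow>
     (\<forall>a\<in>carrier G. \<forall>b\<in>carrier G. lam a b \<noteq> 0) \<and>
     (\<forall>a\<in>carrier G. \<forall>b\<in>carrier G. \<forall>c\<in>carrier G.
        lam a b * lam (a \<otimes>\<^bsub>G\<^esub> b) c = lam b c * lam a (b \<otimes>\<^bsub>G\<^esub> c))"

text \<open>
  The basis element written as $a$ with a bar is \<open>Poly_Mapping.single a 1\<close>. The cocycle is not
  assumed to be normalised, so the unit of the algebra is the bar of the neutral element,
  divided by \<open>lam \<one> \<one>\<close>. For a subgroup \<open>B\<close>, the subalgebra of elements supported in \<open>B\<close> is
  \<open>twisted_group_algebra (G\<lparr>carrier := B\<rparr>) lam\<close>.
\<close>

definition twisted_mult ::
    "('a, 'c) monoid_scheme \<Rightarrow> ('a \<Rightarrow> 'a \<Rightarrow> 'k::field) \<Rightarrow>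
     ('a \<Rightarrow>\<^sub>0 'k) \<Rightarrow> ('a \<Rightarrow>\<^sub>0 'k) \<Rightarrow> ('a \<Rightarrow>\<^sub>0 'k)" where
  "twisted_mult G lam f g =
     (\<Sum>a\<in>Poly_Mapping.keys f. \<Sum>b\<in>Poly_Mapping.keys g.
        Poly_Mapping.single (a \<otimes>\<^bsub>G\<^esub> b)
          (Poly_Mapping.lookup f a * Poly_Mapping.lookup g b * lam a b))"

definition twisted_group_algebra ::
    "('a, 'c) monoid_scheme \<Rightarrow> ('a \<Rightarrow> 'a \<Rightarrow> 'k::field) \<Rightarrow> ('a \<Rightarrow>\<^sub>0 'k) ring" where
  "twisted_group_algebra G lam =
     \<lparr>carrier = {f. Poly_Mapping.keys f \<subseteq> carrier G},
      monoid.mult = twisted_mult G lam,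
      monoid.one = Poly_Mapping.single \<one>\<^bsub>G\<^esub> (inverse (lam \<one>\<^bsub>G\<^esub> \<one>\<^bsub>G\<^esub>)),
      ring.zero = 0,
      ring.add = (+)\<rparr>"

lemma twisted_mult_superset:
  assumes "finite S" "Poly_Mapping.keys f \<subseteq> S" "finite T" "Poly_Mapping.keys g \<subseteq> T"
  shows "twisted_mult G lam f g =
    (\<Sum>a\<in>S. \<Sum>b\<in>T. Poly_Mapping.single (a \<otimes>\<^bsub>G\<^esub> b)
          (Poly_Mapping.lookup f a * Poly_Mapping.lookup g b * lam a b))"
proof -
  have "twisted_mult G lam f g = (\<Sum>a\<in>Poly_Mapping.keys f. \<Sum>b\<in>T. Poly_Mapping.single (a \<otimes>\<^bsub>G\<^esub> b)
          (Poly_Mapping.lookup f a * Poly_Mapping.lookup g b * lam a b))"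
    unfolding twisted_mult_def
    by (rule sum.cong[OF refl], rule sum.mono_neutral_left)
      (use assms in \<open>auto simp: in_keys_iff\<close>)
  also have "\<dots> = (\<Sum>a\<in>S. \<Sum>b\<in>T. Poly_Mapping.single (a \<otimes>\<^bsub>G\<^esub> b)
          (Poly_Mapping.lookup f a * Poly_Mapping.lookup g b * lam a b))"
    by (rule sum.mono_neutral_left) (use assms in \<open>auto simp: in_keys_iff intro!: sum.neutral\<close>)
  finally show ?thesis .
qed

lemma twisted_mult_add_left:
  "twisted_mult G lam (f + f') g = twisted_mult G lam f g + twisted_mult G lam f' g"
proof -
  define S where "S = Poly_Mapping.keys f \<union> Poly_Mapping.keys f'"
  have S: "finite S" "Poly_Mapping.keys f \<subseteq> S" "Poly_Mapping.keys f' \<subseteq> S"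
      "Poly_Mapping.keys (f + f') \<subseteq> S"
    using keys_add[of f f'] by (auto simp: S_def)
  show ?thesis
    by (simp add: twisted_mult_superset[OF S(1) S(2) finite_keys subset_refl]
        twisted_mult_superset[OF S(1) S(3) finite_keys subset_refl]
        twisted_mult_superset[OF S(1) S(4) finite_keys subset_refl]
        lookup_add algebra_simps single_add sum.distrib)
qed

lemma twisted_mult_add_right:
  "twisted_mult G lam g (f + f') = twisted_mult G lam g f + twisted_mult G lam g f'"
proof -
  define S where "S = Poly_Mapping.keys f \<union> Poly_Mapping.keys f'"
  have S: "finite S" "Poly_Mapping.keys f \<subseteq> S" "Poly_Mapping.keys f' \<subseteq> S"
      "Poly_Mapping.keys (f + f') \<subseteq> S"
    using keys_add[of f f'] by (auto simp: S_def)
  show ?thesis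
    by (simp add: twisted_mult_superset[OF finite_keys subset_refl S(1) S(2)]
        twisted_mult_superset[OF finite_keys subset_refl S(1) S(3)]
        twisted_mult_superset[OF finite_keys subset_refl S(1) S(4)]
        lookup_add algebra_simps single_add sum.distrib)
qed

lemma twisted_mult_zero [simp]: "twisted_mult G lam 0 g = 0" "twisted_mult G lam g 0 = 0"
  by (simp_all add: twisted_mult_def)

lemma twisted_mult_single [simp]:
  "twisted_mult G lam (Poly_Mapping.single a x) (Poly_Mapping.single b y) =
     Poly_Mapping.single (a \<otimes>\<^bsub>G\<^esub> b) (x * y * lam a b)"
  by (cases "x = 0"; cases "y = 0") (simp_all add: twisted_mult_def)

lemma twisted_mult_sum_left:
  "twisted_mult G lam (\<Sum>i\<in>I. f i) g = (\<Sum>i\<in>I. twisted_mult G lam (f i) g)"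
  by (induction I rule: infinite_finite_induct) (simp_all add: twisted_mult_add_left)

lemma twisted_mult_sum_right:
  "twisted_mult G lam g (\<Sum>i\<in>I. f i) = (\<Sum>i\<in>I. twisted_mult G lam g (f i))"
  by (induction I rule: infinite_finite_induct) (simp_all add: twisted_mult_add_right)

lemma keys_twisted_mult:
  "Poly_Mapping.keys (twisted_mult G lam f g) \<subseteq>
     (\<Union>a\<in>Poly_Mapping.keys f. \<Union>b\<in>Poly_Mapping.keys g. {a \<otimes>\<^bsub>G\<^esub> b})"
  unfolding twisted_mult_def
  by (intro order_trans[OF keys_sum] UN_mono subset_refl) auto

lemma poly_mapping_sum_single:
  "f = (\<Sum>a\<in>Poly_Mapping.keys f. Poly_Mapping.single a (Poly_Mapping.lookup f a))"
  by (rule poly_mapping_eqI)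
    (auto simp: lookup_sum lookup_single when_def in_keys_iff sum.delta)

lemma twisted_mult_assoc:
  assumes G: "group G" and lam: "two_cocycle G lam"
    and "Poly_Mapping.keys f \<subseteq> carrier G" "Poly_Mapping.keys g \<subseteq> carrier G"
        "Poly_Mapping.keys h \<subseteq> carrier G"
  shows "twisted_mult G lam (twisted_mult G lam f g) h =
         twisted_mult G lam f (twisted_mult G lam g h)"
proof -
  interpret group G by fact
  have *: "twisted_mult G lam (twisted_mult G lam (Poly_Mapping.single a x) (Poly_Mapping.single b y))
             (Poly_Mapping.single c z) =
           twisted_mult G lam (Poly_Mapping.single a x)
             (twisted_mult G lam (Poly_Mapping.single b y) (Poly_Mapping.single c z))"
    if "a \<in> carrier G" "b \<in> carrier G" "c \<in> carrier G" for a b c x y z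
  proof -
    have "lam a b * lam (a \<otimes>\<^bsub>G\<^esub> b) c = lam b c * lam a (b \<otimes>\<^bsub>G\<^esub> c)"
      using lam that unfolding two_cocycle_def by blast
    then have "x * y * z * (lam a b * lam (a \<otimes>\<^bsub>G\<^esub> b) c) = x * y * z * (lam b c * lam a (b \<otimes>\<^bsub>G\<^esub> c))"
      by (rule arg_cong)
    then have "x * y * lam a b * z * lam (a \<otimes>\<^bsub>G\<^esub> b) c = x * (y * z * lam b c) * lam a (b \<otimes>\<^bsub>G\<^esub> c)"
      by (simp only: ac_simps)
    then show ?thesis by (simp only: twisted_mult_single m_assoc[OF that])
  qed
  let ?T = "twisted_mult G lam"
  let ?s = "\<lambda>f a. Poly_Mapping.single a (Poly_Mapping.lookup f a)"
  have h: "?T (?T (?s f a) (?s g b)) h = ?T (?s f a) (?T (?s g b) h)"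
    if "a \<in> carrier G" "b \<in> carrier G" for a b
  proof -
    have "?T (?T (?s f a) (?s g b)) (\<Sum>c\<in>Poly_Mapping.keys h. ?s h c) =
          ?T (?s f a) (?T (?s g b) (\<Sum>c\<in>Poly_Mapping.keys h. ?s h c))"
      unfolding twisted_mult_sum_right by (intro sum.cong refl *) (use assms that in auto)
    then show ?thesis by (simp only: poly_mapping_sum_single[symmetric])
  qed
  have g: "?T (?T (?s f a) g) h = ?T (?s f a) (?T g h)" if "a \<in> carrier G" for a
  proof -
    have "?T (?T (?s f a) (\<Sum>b\<in>Poly_Mapping.keys g. ?s g b)) h =
          ?T (?s f a) (?T (\<Sum>b\<in>Poly_Mapping.keys g. ?s g b) h)"
      unfolding twisted_mult_sum_right twisted_mult_sum_left
      by (intro sum.cong refl h) (use assms that in auto)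
    then show ?thesis by (simp only: poly_mapping_sum_single[symmetric])
  qed
  have "?T (?T (\<Sum>a\<in>Poly_Mapping.keys f. ?s f a) g) h =
        ?T (\<Sum>a\<in>Poly_Mapping.keys f. ?s f a) (?T g h)"
    unfolding twisted_mult_sum_left by (intro sum.cong refl g) (use assms in auto)
  then show ?thesis by (simp only: poly_mapping_sum_single[symmetric])
qed

lemma two_cocycle_one:
  assumes "group G" "two_cocycle G lam" "a \<in> carrier G"
  shows "lam \<one>\<^bsub>G\<^esub> a = lam \<one>\<^bsub>G\<^esub> \<one>\<^bsub>G\<^esub>" "lam a \<one>\<^bsub>G\<^esub> = lam \<one>\<^bsub>G\<^esub> \<one>\<^bsub>G\<^esub>"
proof -
  interpret group G by fact
  have nz: "lam b c \<noteq> 0" if "b \<in> carrier G" "c \<in> carrier G" for b c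
    using assms(2) that by (auto simp: two_cocycle_def)
  have eq: "lam b c * lam (b \<otimes>\<^bsub>G\<^esub> c) d = lam c d * lam b (c \<otimes>\<^bsub>G\<^esub> d)"
    if "b \<in> carrier G" "c \<in> carrier G" "d \<in> carrier G" for b c d
    using assms(2) that unfolding two_cocycle_def by blast
  show "lam \<one>\<^bsub>G\<^esub> a = lam \<one>\<^bsub>G\<^esub> \<one>\<^bsub>G\<^esub>"
    using eq[of "\<one>\<^bsub>G\<^esub>" "\<one>\<^bsub>G\<^esub>" a] nz[of "\<one>\<^bsub>G\<^esub>" a] assms(3) by simp
  show "lam a \<one>\<^bsub>G\<^esub> = lam \<one>\<^bsub>G\<^esub> \<one>\<^bsub>G\<^esub>"
    using eq[of a "\<one>\<^bsub>G\<^esub>" "\<one>\<^bsub>G\<^esub>"] nz[of a "\<one>\<^bsub>G\<^esub>"] assms(3) by simp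
qed

lemma twisted_mult_one:
  assumes "group G" "two_cocycle G lam" "Poly_Mapping.keys f \<subseteq> carrier G"
  shows "twisted_mult G lam (Poly_Mapping.single \<one>\<^bsub>G\<^esub> (inverse (lam \<one>\<^bsub>G\<^esub> \<one>\<^bsub>G\<^esub>))) f = f"
    and "twisted_mult G lam f (Poly_Mapping.single \<one>\<^bsub>G\<^esub> (inverse (lam \<one>\<^bsub>G\<^esub> \<one>\<^bsub>G\<^esub>))) = f"
proof -
  interpret group G by fact
  let ?e = "Poly_Mapping.single \<one>\<^bsub>G\<^esub> (inverse (lam \<one>\<^bsub>G\<^esub> \<one>\<^bsub>G\<^esub>))"
  let ?s = "\<lambda>a. Poly_Mapping.single a (Poly_Mapping.lookup f a)"
  have nz: "lam \<one>\<^bsub>G\<^esub> \<one>\<^bsub>G\<^esub> \<noteq> 0"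
    using assms(2) by (auto simp: two_cocycle_def)
  have l: "twisted_mult G lam ?e (?s a) = ?s a"
   and r: "twisted_mult G lam (?s a) ?e = ?s a" if "a \<in> Poly_Mapping.keys f" for a
  proof -
    have "a \<in> carrier G" using that assms(3) by auto
    then show "twisted_mult G lam ?e (?s a) = ?s a" "twisted_mult G lam (?s a) ?e = ?s a"
      using nz two_cocycle_one[OF assms(1,2) \<open>a \<in> carrier G\<close>] by (simp_all add: field_simps)
  qed
  have "twisted_mult G lam ?e (\<Sum>a\<in>Poly_Mapping.keys f. ?s a) = (\<Sum>a\<in>Poly_Mapping.keys f. ?s a)"
    unfolding twisted_mult_sum_right by (intro sum.cong refl l)
  then show "twisted_mult G lam ?e f = f" by (simp only: poly_mapping_sum_single[symmetric])
  have "twisted_mult G lam (\<Sum>a\<in>Poly_Mapping.keys f. ?s a) ?e = (\<Sum>a\<in>Poly_Mapping.keys f. ?s a)"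
    unfolding twisted_mult_sum_left by (intro sum.cong refl r)
  then show "twisted_mult G lam f ?e = f" by (simp only: poly_mapping_sum_single[symmetric])
qed

lemma ring_twisted_group_algebra:
  assumes "group G" "two_cocycle G lam"
  shows "ring (twisted_group_algebra G lam)"
proof -
  interpret group G by fact
  show ?thesis
  proof (intro ringI abelian_groupI monoidI)
    fix f g
    assume "f \<in> carrier (twisted_group_algebra G lam)" "g \<in> carrier (twisted_group_algebra G lam)"
    then show "f \<otimes>\<^bsub>twisted_group_algebra G lam\<^esub> g \<in> carrier (twisted_group_algebra G lam)"
      using keys_twisted_mult[of G lam f g] by (fastforce simp: twisted_group_algebra_def)
    show "f \<oplus>\<^bsub>twisted_group_algebra G lam\<^esub> g \<in> carrier (twisted_group_algebra G lam)"
      using keys_add[of f g] \<open>f \<in> _\<close> \<open>g \<in> _\<close> by (auto simp: twisted_group_algebra_def)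
  next
    fix f assume "f \<in> carrier (twisted_group_algebra G lam)"
    then show "\<exists>g\<in>carrier (twisted_group_algebra G lam).
        g \<oplus>\<^bsub>twisted_group_algebra G lam\<^esub> f = \<zero>\<^bsub>twisted_group_algebra G lam\<^esub>"
      by (intro bexI[of _ "- f"]) (auto simp: twisted_group_algebra_def)
  qed (auto simp: twisted_group_algebra_def twisted_mult_assoc[OF assms] twisted_mult_one[OF assms]
        twisted_mult_add_left twisted_mult_add_right add_ac)
qed

lemma subring_twisted_group_algebra:
  assumes "group G" "two_cocycle G lam" "subgroup B G"
  shows "subring (carrier (twisted_group_algebra (G\<lparr>carrier := B\<rparr>) lam)) (twisted_group_algebra G lam)"
    and "twisted_group_algebra (G\<lparr>carrier := B\<rparr>) lam =
         (twisted_group_algebra G lam)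
           \<lparr>carrier := carrier (twisted_group_algebra (G\<lparr>carrier := B\<rparr>) lam)\<rparr>"
proof -
  interpret group G by fact
  interpret B: subgroup B G by fact
  have lamB: "two_cocycle (G\<lparr>carrier := B\<rparr>) lam"
    using assms(2) B.subset by (auto simp: two_cocycle_def)
  interpret RB: ring "twisted_group_algebra (G\<lparr>carrier := B\<rparr>) lam"
    by (rule ring_twisted_group_algebra[OF _ lamB]) (rule subgroup_imp_group[OF assms(3)])
  interpret R: ring "twisted_group_algebra G lam"
    by (rule ring_twisted_group_algebra[OF assms(1,2)])
  show eq: "twisted_group_algebra (G\<lparr>carrier := B\<rparr>) lam =
         (twisted_group_algebra G lam)
           \<lparr>carrier := carrier (twisted_group_algebra (G\<lparr>carrier := B\<rparr>) lam)\<rparr>"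
    by (simp add: twisted_group_algebra_def twisted_mult_def fun_eq_iff)
  show "subring (carrier (twisted_group_algebra (G\<lparr>carrier := B\<rparr>) lam)) (twisted_group_algebra G lam)"
  proof (rule R.subring_iff[THEN iffD2])
    show "carrier (twisted_group_algebra (G\<lparr>carrier := B\<rparr>) lam) \<subseteq> carrier (twisted_group_algebra G lam)"
      using B.subset by (auto simp: twisted_group_algebra_def)
    show "ring (twisted_group_algebra G lam
        \<lparr>carrier := carrier (twisted_group_algebra (G\<lparr>carrier := B\<rparr>) lam)\<rparr>)"
      by (subst eq[symmetric]) (rule RB.ring_axioms)
  qed
qed


section \<open>Right modules over a ring that need not be commutative\<close>

text \<open>
  The library's record of modules is reused, but its scalar multiplication is a right action here:
  \<open>a \<odot>\<^bsub>M\<^esub> x\<close> stands for $x \cdot a$, so that \<open>(a \<otimes> b) \<odot>\<^bsub>M\<^esub> x\<close> is $(x \cdot a) \cdot b$.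
\<close>

locale right_module = R?: ring R + M?: abelian_group M
  for R :: "('r, 'e) ring_scheme" (structure) and M :: "('r, 'u, 'f) module_scheme" (structure) +
  assumes smult_closed:
      "\<lbrakk>a \<in> carrier R; x \<in> carrier M\<rbrakk> \<Longrightarrow> a \<odot>\<^bsub>M\<^esub> x \<in> carrier M"
    and smult_l_distr:
      "\<lbrakk>a \<in> carrier R; b \<in> carrier R; x \<in> carrier M\<rbrakk> \<Longrightarrow>
         (a \<oplus> b) \<odot>\<^bsub>M\<^esub> x = a \<odot>\<^bsub>M\<^esub> x \<oplus>\<^bsub>M\<^esub> b \<odot>\<^bsub>M\<^esub> x"
    and smult_r_distr:
      "\<lbrakk>a \<in> carrier R; x \<in> carrier M; y \<in> carrier M\<rbrakk> \<Longrightarrow>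
         a \<odot>\<^bsub>M\<^esub> (x \<oplus>\<^bsub>M\<^esub> y) = a \<odot>\<^bsub>M\<^esub> x \<oplus>\<^bsub>M\<^esub> a \<odot>\<^bsub>M\<^esub> y"
    and smult_right_action:
      "\<lbrakk>a \<in> carrier R; b \<in> carrier R; x \<in> carrier M\<rbrakk> \<Longrightarrow>
         (a \<otimes> b) \<odot>\<^bsub>M\<^esub> x = b \<odot>\<^bsub>M\<^esub> (a \<odot>\<^bsub>M\<^esub> x)"
    and smult_one:
      "x \<in> carrier M \<Longrightarrow> \<one> \<odot>\<^bsub>M\<^esub> x = x"

definition simple_right_module ::
    "('r, 'e) ring_scheme \<Rightarrow> ('r, 'u, 'f) module_scheme \<Rightarrow> bool" where
  "simple_right_module R M \<longleftrightarrow>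
     right_module R M \<and> carrier M \<noteq> {\<zero>\<^bsub>M\<^esub>} \<and>
     (\<forall>N. submodule N R M \<longrightarrow> N = {\<zero>\<^bsub>M\<^esub>} \<or> N = carrier M)"

definition finitely_generated_right_module ::
    "('r, 'e) ring_scheme \<Rightarrow> ('r, 'u, 'f) module_scheme \<Rightarrow> bool" where
  "finitely_generated_right_module R M \<longleftrightarrow>
     right_module R M \<and>
     (\<exists>S. finite S \<and> S \<subseteq> carrier M \<and>
        (\<forall>x\<in>carrier M. \<exists>c\<in>S \<rightarrow> carrier R. x = (\<Oplus>\<^bsub>M\<^esub>s\<in>S. c s \<odot>\<^bsub>M\<^esub> s)))"

definition torsion_right_module ::
    "('r, 'e) ring_scheme \<Rightarrow> ('r, 'u, 'f) module_scheme \<Rightarrow> bool" where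
  "torsion_right_module R M \<longleftrightarrow>
     right_module R M \<and>
     (\<forall>x\<in>carrier M. \<exists>r\<in>carrier R - {\<zero>\<^bsub>R\<^esub>}. r \<odot>\<^bsub>M\<^esub> x = \<zero>\<^bsub>M\<^esub>)"


section \<open>Global dimension\<close>

definition right_module_hom ::
    "('r, 'e) ring_scheme \<Rightarrow> ('r, 'u, 'f) module_scheme \<Rightarrow> ('r, 'v, 'g) module_scheme \<Rightarrow>
     ('u \<Rightarrow> 'v) set" where
  "right_module_hom R M N =
     {h \<in> carrier M \<rightarrow> carrier N.
        (\<forall>x\<in>carrier M. \<forall>y\<in>carrier M. h (x \<oplus>\<^bsub>M\<^esub> y) = h x \<oplus>\<^bsub>N\<^esub> h y) \<and>
        (\<forall>r\<in>carrier R. \<forall>x\<in>carrier M. h (r \<odot>\<^bsub>M\<^esub> x) = r \<odot>\<^bsub>N\<^esub> h x)}"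

text \<open>
  Quantification over all modules needs a universe: a type \<open>'t\<close> whose subsets serve as the carriers
  of all modules considered (the module itself, the terms of its resolutions, and the modules
  testing projectivity). As soon as \<open>'t\<close> is infinite and has at least the cardinality of \<open>R\<close>, this is
  no restriction: the free module on a subset of \<open>'t\<close>, and with it every submodule and quotient of
  it, is isomorphic to a module carried by a subset of \<open>'t\<close>. Hence projectivity and projective
  dimension have their usual meaning. By Auslander's theorem, the supremum over these modules,
  which include all cyclic ones up to isomorphism, is the one over all modules.
\<close>

definition projective_right_module ::
    "('r, 'e) ring_scheme \<Rightarrow> ('r, 't) module \<Rightarrow> bool" where
  "projective_right_module R P \<longleftrightarrow>
     right_module R P \<and>
     (\<forall>(V :: ('r, 't) module) (W :: ('r, 't) module) p f.
        right_module R V \<longrightarrow> right_module R W \<longrightarrow>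
        p \<in> right_module_hom R V W \<longrightarrow> p ` carrier V = carrier W \<longrightarrow>
        f \<in> right_module_hom R P W \<longrightarrow>
        (\<exists>g\<in>right_module_hom R P V. \<forall>x\<in>carrier P. p (g x) = f x))"

text \<open>
  A projective resolution of \<open>C 0\<close> of length \<open>n\<close>, that is, an exact sequence
  \<open>0 \<rightarrow> C (n+1) \<rightarrow> \<dots> \<rightarrow> C 1 \<rightarrow> C 0 \<rightarrow> 0\<close> in which all terms but \<open>C 0\<close> are projective. Note the
  shift of the indices: the projective module in homological degree \<open>i\<close> is \<open>C (i+1)\<close>.
\<close>

definition projective_resolution ::
    "('r, 'e) ring_scheme \<Rightarrow> nat \<Rightarrow> (nat \<Rightarrow> ('r, 't) module) \<Rightarrow> (nat \<Rightarrow> 't \<Rightarrow> 't) \<Rightarrow> bool" where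
  "projective_resolution R n C d \<longleftrightarrow>
     right_module R (C 0) \<and>
     (\<forall>i\<le>n. projective_right_module R (C (Suc i))) \<and>
     (\<forall>i\<le>n. d i \<in> right_module_hom R (C (Suc i)) (C i)) \<and>
     d 0 ` carrier (C 1) = carrier (C 0) \<and>
     (\<forall>i<n. d (Suc i) ` carrier (C (Suc (Suc i))) = a_kernel (C (Suc i)) (C i) (d i)) \<and>
     inj_on (d n) (carrier (C (Suc n)))"

text \<open>The infimum of the empty set is \<open>\<infinity>\<close>.\<close>

definition projective_dimension ::
    "('r, 'e) ring_scheme \<Rightarrow> ('r, 't) module \<Rightarrow> enat" where
  "projective_dimension R M =
     (INF n \<in> {n. \<exists>C d. C 0 = M \<and> projective_resolution R n C d}. enat n)"

text \<open>
  The universe \<open>'r \<times> 'm\<close>, with an arbitrary type \<open>'m\<close>, is at least as large as \<open>R\<close>, so the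
  remark above applies whenever \<open>R\<close> is infinite.
\<close>

definition right_global_dimension :: "'m itself \<Rightarrow> ('r, 'e) ring_scheme \<Rightarrow> enat" where
  "right_global_dimension (_ :: 'm itself) R =
     (SUP M \<in> {M :: ('r, 'r \<times> 'm) module. right_module R M}. projective_dimension R M)"

end

theory Submission
  imports Defs
begin

text \<open>
  Let \<open>u\<close> generate \<open>U\<close> and let \<open>I\<close> be its annihilator, a proper right ideal. If \<open>U\<close> were torsion over
  \<open>F * B\<close>, then \<open>I\<close> would contain a nonzero \<open>b\<close> supported in \<open>B\<close>; by finite generation over \<open>F * B\<close> it
  also contains an element \<open>p\<close> which is monic in a generator of \<open>A/B\<close>. The algebra is an Ore domain, so a
  homomorphism from \<open>I\<close> to the algebra is left multiplication by a fraction \<open>q\<close>. Since \<open>q b\<close> and \<open>q p\<close> lie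
  in the algebra, comparing leading coefficients shows that \<open>q\<close> does. On the other hand, global
  dimension at most one makes \<open>I\<close> projective, and the dual basis lemma would put \<open>1\<close> into \<open>I\<close>.
\<close>

section \<open>Torsion-free abelian groups\<close>

text \<open>In the commutative picture \<open>b\<close> and \<open>p\<close> cut down two
  independent directions, so I would have codimension two, whereas a projective proper right ideal
  can only have codimension one; the fractions q detect this. The skew field of fractions is not
  formed: for a homomorphism f on I, one pair r, z with p r = b z and r nonzero gives (f p) r = (f
  b) z, and leading coefficients are compared in this equation. Only the value f b is shown to be a
  left multiple of b, which suffices because the dual basis identity is applied to b alone. A second
  obstacle is the universe of modules: projectivity is tested on modules carried by subsets of one
  fixed type, so U, the algebra, I and the free module on the set I are first injected into that
  type. Projectivity of I is used in the form of a section of the evaluation map from that free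
  module onto I; the coordinates of the section are the homomorphisms of a dual basis.\<close>

lemma (in comm_group) torsion_free_positive_cone:
  assumes "torsion_free_group G"
  obtains P where "P \<subseteq> carrier G" "\<And>x y. x \<in> P \<Longrightarrow> y \<in> P \<Longrightarrow> x \<otimes> y \<in> P" "\<one> \<notin> P"
    "\<And>x. x \<in> carrier G \<Longrightarrow> x \<noteq> \<one> \<Longrightarrow> x \<in> P \<or> inv x \<in> P"
proof -
  \<comment> \<open>A maximal subsemigroup that omits the neutral element will be the positive cone
    of a translation-invariant total order.\<close>
  define \<C> where "\<C> = {P. P \<subseteq> carrier G \<and> (\<forall>x\<in>P. \<forall>y\<in>P. x \<otimes> y \<in> P) \<and> \<one> \<notin> P}"
  have "\<exists>M\<in>\<C>. \<forall>T\<in>\<C>. M \<subseteq> T \<longrightarrow> T = M"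
  proof (rule subset_Zorn')
    fix C assume C: "subset.chain \<C> C"
    then have sub: "C \<subseteq> \<C>" and tot: "\<And>T Y. T \<in> C \<Longrightarrow> Y \<in> C \<Longrightarrow> T \<subseteq> Y \<or> Y \<subseteq> T"
      by (auto simp: subset_chain_def)
    have "x \<otimes> y \<in> \<Union>C" if "x \<in> \<Union>C" "y \<in> \<Union>C" for x y
    proof -
      from that obtain T Y where "T \<in> C" "x \<in> T" "Y \<in> C" "y \<in> Y" by blast
      with tot[of T Y] obtain Z where "Z \<in> C" "x \<in> Z" "y \<in> Z" by blast
      with sub show ?thesis by (auto simp: \<C>_def)
    qed
    with sub show "\<Union>C \<in> \<C>" by (auto simp: \<C>_def)
  qed
  then obtain P where P: "P \<in> \<C>" and max: "\<And>T. T \<in> \<C> \<Longrightarrow> P \<subseteq> T \<Longrightarrow> T = P"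
    by blast
  have sub: "P \<subseteq> carrier G" and mult: "\<And>x y. x \<in> P \<Longrightarrow> y \<in> P \<Longrightarrow> x \<otimes> y \<in> P" and one: "\<one> \<notin> P"
    using P by (auto simp: \<C>_def)
  have pow_P: "x [^] n \<in> P" if "x \<in> P" "n > 0" for x and n :: nat
    using that(2)
  proof (induction n)
    case (Suc n)
    then show ?case using that(1) mult sub by (cases "n = 0") auto
  qed simp
  have key: "\<exists>n>0. inv x [^] (n::nat) \<in> P" if x: "x \<in> carrier G" "x \<noteq> \<one>" "x \<notin> P" for x
  proof (rule ccontr)
    assume *: "\<not> ?thesis"
    \<comment> \<open>The semigroup generated by P and x. Torsion-freeness prevents a positive power
      of x from being neutral, so the neutral element could enter only through some p \<in> P
      inverse to a positive power of x, which is excluded here.\<close>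
    define Q where "Q = {p \<otimes> x [^] n | p n. p \<in> insert \<one> P \<and> (p \<in> P \<or> n > (0::nat))}"
    have "Q \<in> \<C>"
      unfolding \<C>_def
    proof (intro CollectI conjI ballI)
      show "Q \<subseteq> carrier G" using sub x(1) by (auto simp: Q_def)
    next
      fix y z assume "y \<in> Q" "z \<in> Q"
      then obtain p n q m where
        y: "y = p \<otimes> x [^] n" "p \<in> insert \<one> P" "p \<in> P \<or> n > (0::nat)" and
        z: "z = q \<otimes> x [^] m" "q \<in> insert \<one> P" "q \<in> P \<or> m > (0::nat)"
        unfolding Q_def by blast
      have pq: "p \<in> carrier G" "q \<in> carrier G" using y z sub by auto
      have "y \<otimes> z = (p \<otimes> q) \<otimes> x [^] (n + m)"
        using pq x(1) by (simp add: y z m_ac nat_pow_mult[symmetric])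
      moreover have "p \<otimes> q \<in> insert \<one> P" "p \<otimes> q \<in> P \<or> n + m > 0"
        using y(2,3) z(2,3) pq mult by auto
      ultimately show "y \<otimes> z \<in> Q" unfolding Q_def by blast
    next
      show "\<one> \<notin> Q"
      proof
        assume "\<one> \<in> Q"
        then obtain p n where pn: "\<one> = p \<otimes> x [^] n" "p \<in> insert \<one> P" "p \<in> P \<or> n > (0::nat)"
          unfolding Q_def by blast
        have p: "p \<in> carrier G" using pn sub by auto
        have "p \<in> P \<and> n > 0"
        proof (cases "p \<in> P")
          case True
          then show ?thesis using pn(1) one p by (cases "n = 0") auto
        next
          case False
          then show ?thesis
            using pn x(1,2) assms by (auto simp: torsion_free_group_def)
        qed
        moreover have "p = inv (x [^] n)"
          using pn(1) p x(1) by (intro inv_equality[symmetric]) auto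
        ultimately show False
          using * x(1) by (metis nat_pow_inv)
      qed
    qed
    moreover have "P \<subseteq> Q"
    proof
      fix p assume "p \<in> P"
      then have "p = p \<otimes> x [^] (0::nat)" using sub by auto
      then show "p \<in> Q"
        using \<open>p \<in> P\<close> unfolding Q_def by (intro CollectI exI[of _ p] exI[of _ 0]) simp
    qed
    moreover have "x \<in> Q"
    proof -
      have "x = \<one> \<otimes> x [^] (1::nat)" using x(1) by simp
      then show ?thesis unfolding Q_def by (intro CollectI exI[of _ \<one>] exI[of _ 1]) simp
    qed
    ultimately show False using max[of Q] x(3) by simp
  qed
  show thesis
  proof (rule that[OF sub mult one])
    fix x assume x: "x \<in> carrier G" "x \<noteq> \<one>"
    show "x \<in> P \<or> inv x \<in> P"
    proof (rule ccontr)
      assume "\<not> ?thesis"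
      then have "x \<notin> P" "inv x \<notin> P" by simp_all
      then obtain n m :: nat where nm: "n > 0" "inv x [^] n \<in> P" "m > 0" "x [^] m \<in> P"
        using key[OF x] key[of "inv x"] x(1) inv_eq_1_iff[OF x(1)] x(2)
        by (metis inv_closed inv_inv)
      \<comment> \<open>The outer powers equalise the exponents, so the two factors are inverse to
        each other.\<close>
      have "(inv x [^] n) [^] m \<otimes> (x [^] m) [^] n \<in> P"
        by (intro mult pow_P nm)
      moreover have "(inv x [^] n) [^] m = inv ((x [^] m) [^] n)"
        using x(1) by (simp add: nat_pow_pow nat_pow_inv[symmetric] mult.commute)
      ultimately show False using one x(1) by simp
    qed
  qed
qed

text \<open>In the order given by a positive cone, take the largest elements s and t of S and T:
  every other pair has a strictly smaller product.\<close>

lemma (in comm_group) torsion_free_unique_product: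
  assumes "torsion_free_group G"
    and "finite S" "S \<noteq> {}" "S \<subseteq> carrier G" "finite T" "T \<noteq> {}" "T \<subseteq> carrier G"
  obtains s t where "s \<in> S" "t \<in> T"
    "\<And>s' t'. s' \<in> S \<Longrightarrow> t' \<in> T \<Longrightarrow> s' \<otimes> t' = s \<otimes> t \<Longrightarrow> s' = s \<and> t' = t"
proof -
  obtain P where P: "P \<subseteq> carrier G" "\<And>x y. x \<in> P \<Longrightarrow> y \<in> P \<Longrightarrow> x \<otimes> y \<in> P" "\<one> \<notin> P"
    "\<And>x. x \<in> carrier G \<Longrightarrow> x \<noteq> \<one> \<Longrightarrow> x \<in> P \<or> inv x \<in> P"
    using torsion_free_positive_cone[OF assms(1)] by blast
  \<comment> \<open>In that order, \<open>m \<otimes> inv x \<in> P\<close> reads x < m.\<close>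
  have max: "\<exists>m\<in>Z. \<forall>x\<in>Z. x \<noteq> m \<longrightarrow> m \<otimes> inv x \<in> P"
    if "finite Z" "Z \<noteq> {}" "Z \<subseteq> carrier G" for Z
    using that
  proof (induction Z rule: finite_ne_induct)
    case (insert y Z)
    then obtain m where m: "m \<in> Z" "\<And>x. x \<in> Z \<Longrightarrow> x \<noteq> m \<Longrightarrow> m \<otimes> inv x \<in> P" by auto
    have c: "m \<in> carrier G" "y \<in> carrier G" using insert m by auto
    have "m \<otimes> inv y \<noteq> \<one>"
      using c m(1) insert.hyps by (metis inv_equality inv_inv inv_closed)
    then consider "m \<otimes> inv y \<in> P" | "y \<otimes> inv m \<in> P"
      using P(4)[of "m \<otimes> inv y"] c by (auto simp: inv_mult_group)
    then show ?case
    proof cases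
      case 1
      then show ?thesis using m by auto
    next
      case 2
      have "y \<otimes> inv x \<in> P" if "x \<in> Z" for x
      proof (cases "x = m")
        case False
        have x: "x \<in> carrier G" using that insert by auto
        have "(y \<otimes> inv m) \<otimes> (m \<otimes> inv x) = y \<otimes> inv x"
          using x c by (metis inv_closed m_assoc m_closed l_inv l_one)
        then show ?thesis using P(2)[OF 2 m(2)[OF that False]] by simp
      qed (use 2 in simp)
      then show ?thesis by auto
    qed
  qed auto
  obtain s where s: "s \<in> S" "\<And>x. x \<in> S \<Longrightarrow> x \<noteq> s \<Longrightarrow> s \<otimes> inv x \<in> P"
    using max[OF assms(2-4)] by blast
  obtain t where t: "t \<in> T" "\<And>x. x \<in> T \<Longrightarrow> x \<noteq> t \<Longrightarrow> t \<otimes> inv x \<in> P"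
    using max[OF assms(5-7)] by blast
  show thesis
  proof (rule that[OF s(1) t(1)])
    fix s' t' assume st: "s' \<in> S" "t' \<in> T" "s' \<otimes> t' = s \<otimes> t"
    have c: "s \<in> carrier G" "t \<in> carrier G" "s' \<in> carrier G" "t' \<in> carrier G"
      using s t st assms by auto
    have "(s \<otimes> inv s') \<otimes> (t \<otimes> inv t') = (s \<otimes> t) \<otimes> inv (s' \<otimes> t')"
      using c by (simp add: inv_mult m_ac)
    then have e: "(s \<otimes> inv s') \<otimes> (t \<otimes> inv t') = \<one>"
      using st(3) c by simp
    have "s' = s"
    proof (rule ccontr)
      assume "s' \<noteq> s"
      then have "s \<otimes> inv s' \<in> P" using s st by auto
      moreover have "t \<otimes> inv t' \<in> insert \<one> P"
        using t(2)[OF st(2)] c by (cases "t' = t") auto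
      ultimately show False
        using e P(2)[of "s \<otimes> inv s'" "t \<otimes> inv t'"] P(3) c by auto
    qed
    moreover from this have "t' = t" using st(3) c by simp
    ultimately show "s' = s \<and> t' = t" by simp
  qed
qed

section \<open>Polynomial growth of abelian groups\<close>

lemma exp_not_le_polynomial: "\<exists>n. (n + 1) ^ d < (2::nat) ^ n"
proof -
  \<comment> \<open>With n + 1 = 2^(2k) both sides are powers of two, and the claim becomes 2kd <
    2^(2k) - 1. For k = 2d + 1 the left side is k(k - 1), which is small enough because 2^k is at
    least k + 1.\<close>
  define k where "k = 2 * d + 1"
  have "k + 1 \<le> 2 ^ k" using less_exp[of k] by linarith
  then have "(k + 1) * (k + 1) \<le> 2 ^ k * (2::nat) ^ k"
    by (intro mult_mono) simp_all
  also have "\<dots> = 2 ^ (2 * k)" by (simp only: mult_2 power_add)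
  finally have le: "(k + 1) * (k + 1) \<le> 2 ^ (2 * k)" .
  have "2 * k * d + 1 < (k + 1) * (k + 1)" by (simp add: k_def algebra_simps)
  with le have "2 * k * d < 2 ^ (2 * k) - 1" by linarith
  then have "(2 ^ (2 * k)) ^ d < (2::nat) ^ (2 ^ (2 * k) - 1)"
    unfolding power_mult[symmetric] by (rule power_strict_increasing) simp
  then show ?thesis by (intro exI[of _ "2 ^ (2 * k) - 1"]) (simp del: power_mult)
qed

text \<open>The boxes of products with all exponents at most n satisfy E W(n) \<subseteq> W(n+1) and
  grow polynomially in n, so their size cannot double at every step. The factor 2 is the number of
  unknown elements in the Ore condition.\<close>

lemma (in comm_group) small_doubling:
  assumes E: "finite E" "E \<subseteq> carrier G"
  obtains Z where "finite Z" "Z \<subseteq> carrier G" "Z \<noteq> {}" "card (E <#> Z) < 2 * card Z"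
proof -
  define W where "W n = (\<lambda>k. finprod G (\<lambda>e. e [^] k e) E) ` (E \<rightarrow>\<^sub>E {..n})" for n :: nat
  have fin: "finite (W n)" for n
    using E(1) by (auto simp: W_def intro!: finite_PiE)
  have sub: "W n \<subseteq> carrier G" for n
    using E(2) by (auto simp: W_def intro!: finprod_closed)
  have ne: "W n \<noteq> {}" for n
    by (auto simp: W_def PiE_eq_empty_iff)
  have card_W: "card (W n) \<le> (n + 1) ^ card E" for n
    using card_image_le[of "E \<rightarrow>\<^sub>E {..n}"] E(1)
    by (simp add: W_def finite_PiE card_PiE)
  have step: "E <#> W n \<subseteq> W (Suc n)" for n
  proof
    fix y assume "y \<in> E <#> W n"
    then obtain e k where e: "e \<in> E" and k: "k \<in> E \<rightarrow>\<^sub>E {..n}"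
      and y: "y = e \<otimes> finprod G (\<lambda>e. e [^] k e) E"
      by (auto simp: set_mult_def W_def)
    \<comment> \<open>Multiplication by e raises the exponent of e alone, so this factor is split
      off from the product on both sides.\<close>
    let ?k = "k(e := Suc (k e))"
    have c: "(\<lambda>e. e [^] k' e) \<in> Z \<rightarrow> carrier G" if "Z \<subseteq> E" for k' :: "'a \<Rightarrow> nat" and Z
      using that E(2) by auto
    have split: "finprod G (\<lambda>e. e [^] k' e) E = e [^] k' e \<otimes> finprod G (\<lambda>e. e [^] k' e) (E - {e})"
      for k' :: "'a \<Rightarrow> nat"
      using finprod_insert[of "E - {e}" e "\<lambda>e. e [^] k' e"] E e c
      by (auto simp: insert_absorb)
    have eq: "finprod G (\<lambda>e. e [^] ?k e) (E - {e}) = finprod G (\<lambda>e. e [^] k e) (E - {e})"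
      using E(2) by (intro finprod_cong) auto
    have "y = finprod G (\<lambda>e. e [^] ?k e) E"
      unfolding y split[of ?k] split[of k] eq using e E(2) c[of "E - {e}" k]
      by (simp add: m_assoc[symmetric] m_comm[of e] subset_iff)
    moreover have "?k \<in> E \<rightarrow>\<^sub>E {..Suc n}"
      using k e by (auto simp: PiE_iff extensional_def le_Suc_eq)
    ultimately show "y \<in> W (Suc n)"
      unfolding W_def by (rule image_eqI)
  qed
  have "\<exists>n. card (W (Suc n)) < 2 * card (W n)"
  proof (rule ccontr)
    assume *: "\<not> ?thesis"
    have "2 ^ n \<le> card (W n)" for n
    proof (induction n)
      case 0
      then show ?case using fin ne by (simp add: Suc_le_eq card_gt_0_iff)
    next
      case (Suc n)
      then show ?case using *[unfolded not_ex not_less, rule_format, of n] by simp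
    qed
    then have "2 ^ n \<le> (n + 1) ^ card E" for n
      using card_W[of n] le_trans by blast
    then show False using exp_not_le_polynomial[of "card E"] by (metis not_less)
  qed
  then obtain n where "card (W (Suc n)) < 2 * card (W n)" ..
  with card_mono[OF fin step, of n] show thesis
    by (intro that[OF fin sub ne]) (rule le_less_trans)
qed

text \<open>This degree grades the algebra by the integers with F * B in degree zero. It is the
  exponent of a coset with respect to a generator of the quotient, which is unique because that
  generator has infinite order (\<open>ord\<close> equal to 0).\<close>

lemma (in comm_group) infinite_cyclic_quotient_degree:
  assumes B: "subgroup B G" and cyc: "cyclic_group (G Mod B)" and inf: "infinite (carrier (G Mod B))"
  shows "\<exists>(\<phi> :: 'a \<Rightarrow> int) x.
    (\<forall>a\<in>carrier G. \<forall>b\<in>carrier G. \<phi> (a \<otimes> b) = \<phi> a + \<phi> b) \<and>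
    (\<forall>a\<in>carrier G. \<phi> a = 0 \<longleftrightarrow> a \<in> B) \<and> x \<in> carrier G \<and> \<phi> x = 1"
proof -
  interpret N: normal B G using B by (rule subgroup_imp_normal)
  interpret Q: group "G Mod B" by (rule N.factorgroup_is_group)
  obtain g where g: "g \<in> carrier (G Mod B)"
    and gen: "carrier (G Mod B) = range (\<lambda>n::int. g [^]\<^bsub>G Mod B\<^esub> n)"
    using cyc Q.cyclic_group by blast
  have ord: "Q.ord g = 0"
  proof (rule ccontr)
    assume ne: "Q.ord g \<noteq> 0"
    have "g [^]\<^bsub>G Mod B\<^esub> n \<in> (\<lambda>n. g [^]\<^bsub>G Mod B\<^esub> n) ` {0..<int (Q.ord g)}" for n :: int
      using ne g by (intro image_eqI[of _ _ "n mod int (Q.ord g)"])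
        (auto simp: Q.int_pow_eq mod_eq_dvd_iff[symmetric])
    then have "carrier (G Mod B) \<subseteq> (\<lambda>n. g [^]\<^bsub>G Mod B\<^esub> n) ` {0..<int (Q.ord g)}"
      unfolding gen by blast
    then show False using inf finite_subset by blast
  qed
  then have inj: "g [^]\<^bsub>G Mod B\<^esub> n = g [^]\<^bsub>G Mod B\<^esub> m \<longleftrightarrow> n = m" for n m :: int
    using g by (auto simp: Q.int_pow_eq)
  define \<phi> where "\<phi> a = (THE n :: int. B #> a = g [^]\<^bsub>G Mod B\<^esub> n)" for a
  have coset: "B #> a \<in> carrier (G Mod B)" if "a \<in> carrier G" for a
    using that N.subset by (auto simp: FactGroup_def intro: rcosetsI)
  have \<phi>: "B #> a = g [^]\<^bsub>G Mod B\<^esub> n \<longleftrightarrow> \<phi> a = n" if "a \<in> carrier G" for a n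
  proof -
    obtain m where m: "B #> a = g [^]\<^bsub>G Mod B\<^esub> (m::int)"
      using coset[OF \<open>a \<in> carrier G\<close>] gen by blast
    then show ?thesis by (auto simp: \<phi>_def inj)
  qed
  have "\<phi> (a \<otimes> b) = \<phi> a + \<phi> b" if ab: "a \<in> carrier G" "b \<in> carrier G" for a b
  proof -
    have "B #> (a \<otimes> b) = (B #> a) \<otimes>\<^bsub>G Mod B\<^esub> (B #> b)"
      using ab by (simp add: FactGroup_def N.rcos_sum)
    also have "\<dots> = g [^]\<^bsub>G Mod B\<^esub> (\<phi> a) \<otimes>\<^bsub>G Mod B\<^esub> g [^]\<^bsub>G Mod B\<^esub> (\<phi> b)"
      by (simp only: iffD2[OF \<phi>[OF ab(1)] refl] iffD2[OF \<phi>[OF ab(2)] refl])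
    also have "\<dots> = g [^]\<^bsub>G Mod B\<^esub> (\<phi> a + \<phi> b)"
      using g by (simp add: Q.int_pow_mult)
    finally show ?thesis using \<phi> ab by simp
  qed
  moreover have "\<phi> a = 0 \<longleftrightarrow> a \<in> B" if "a \<in> carrier G" for a
  proof -
    have "\<phi> a = 0 \<longleftrightarrow> B #> a = B"
      using \<phi>[OF that, of 0] by (auto simp: FactGroup_def)
    also have "\<dots> \<longleftrightarrow> a \<in> B"
      using that B by (metis coset_join1 coset_join2 N.subset)
    finally show ?thesis .
  qed
  moreover obtain x where "x \<in> carrier G" "g = B #> x"
    using g by (auto simp: FactGroup_def RCOSETS_def)
  moreover from this have "\<phi> x = 1"
    using \<phi>[of x 1] g by simp
  ultimately show ?thesis by blast
qed

section \<open>Linear algebra: fewer equations than unknowns\<close>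

lemma homogeneous_system_nontrivial_solution:
  fixes M :: "'i \<Rightarrow> 'y \<Rightarrow> 'k::field"
  assumes "finite Y" "finite I" "card Y < card I"
  shows "\<exists>c. (\<exists>i\<in>I. c i \<noteq> 0) \<and> (\<forall>y\<in>Y. (\<Sum>i\<in>I. c i * M i y) = 0)"
  using assms
proof (induction Y arbitrary: I M rule: finite_induct)
  case empty
  then have "I \<noteq> {}" by auto
  then show ?case by (intro exI[of _ "\<lambda>_. 1"]) auto
next
  case (insert y Y)
  show ?case
  proof (cases "\<exists>j\<in>I. M j y \<noteq> 0")
    case False
    moreover obtain c where "\<exists>i\<in>I. c i \<noteq> 0" "\<forall>y\<in>Y. (\<Sum>i\<in>I. c i * M i y) = 0"
      using insert.IH[of I M] insert.prems insert.hyps by auto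
    ultimately show ?thesis by (intro exI[of _ c]) auto
  next
    case True
    then obtain j where j: "j \<in> I" "M j y \<noteq> 0" by blast
    \<comment> \<open>Gaussian elimination: equation y, with pivot M j y, is used to remove the
      unknown j from all other equations.\<close>
    let ?M = "\<lambda>i z. M i z - M i y / M j y * M j z"
    have "card Y < card (I - {j})"
      using insert.prems insert.hyps j(1) by simp
    then obtain c where c: "\<exists>i\<in>I - {j}. c i \<noteq> 0" "\<forall>z\<in>Y. (\<Sum>i\<in>I - {j}. c i * ?M i z) = 0"
      using insert.IH[of "I - {j}" ?M] insert.prems by auto
    \<comment> \<open>The value of the removed unknown that equation y dictates.\<close>
    let ?d = "- (\<Sum>i\<in>I - {j}. c i * M i y) / M j y"
    let ?c = "c(j := ?d)"
    have split: "(\<Sum>i\<in>I. ?c i * M i z) = ?d * M j z + (\<Sum>i\<in>I - {j}. c i * M i z)" for z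
      using sum.remove[OF insert.prems(1) j(1), of "\<lambda>i. ?c i * M i z"]
      by (auto intro!: sum.cong)
    have "(\<Sum>i\<in>I. ?c i * M i z) = (\<Sum>i\<in>I - {j}. c i * ?M i z)" for z
      unfolding split
      by (simp add: right_diff_distrib sum_subtractf sum_divide_distrib sum_distrib_left mult_ac)
    moreover have "(\<Sum>i\<in>I. ?c i * M i y) = 0"
      unfolding split using j(2) by simp
    ultimately have "\<forall>z\<in>insert y Y. (\<Sum>i\<in>I. ?c i * M i z) = 0"
      using c(2) by auto
    moreover have "\<exists>i\<in>I. ?c i \<noteq> 0" using c(1) by auto
    ultimately show ?thesis by blast
  qed
qed

section \<open>Twisted group algebras of torsion-free abelian groups\<close>

locale torsion_free_twisted_algebra = comm_group A
  for A :: "('a, 'c) monoid_scheme" (structure) +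
  fixes lam :: "'a \<Rightarrow> 'a \<Rightarrow> 'k::field"
  assumes cocycle: "two_cocycle A lam" and torsion_free: "torsion_free_group A"
begin

abbreviation tmult (infixl "\<star>" 70) where "f \<star> g \<equiv> twisted_mult A lam f g"

abbreviation K where "K \<equiv> {f :: 'a \<Rightarrow>\<^sub>0 'k. Poly_Mapping.keys f \<subseteq> carrier A}"

abbreviation tone where
  "tone \<equiv> Poly_Mapping.single \<one>\<^bsub>A\<^esub> (inverse (lam \<one>\<^bsub>A\<^esub> \<one>\<^bsub>A\<^esub>))"

lemma lam_nonzero: "a \<in> carrier A \<Longrightarrow> b \<in> carrier A \<Longrightarrow> lam a b \<noteq> 0"
  using cocycle by (auto simp: two_cocycle_def)

lemma tmult_closed: "f \<in> K \<Longrightarrow> g \<in> K \<Longrightarrow> f \<star> g \<in> K"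
  using keys_twisted_mult[of A lam f g] by fastforce

lemma K_add: "f \<in> K \<Longrightarrow> g \<in> K \<Longrightarrow> f + g \<in> K"
  using keys_add[of f g] by auto

lemma K_diff: "f \<in> K \<Longrightarrow> g \<in> K \<Longrightarrow> f - g \<in> K"
  using keys_diff[of f g] by auto

lemma K_sum: "(\<And>i. i \<in> I \<Longrightarrow> f i \<in> K) \<Longrightarrow> sum f I \<in> K"
  using keys_sum[of f I] by fastforce

lemma K_single: "a \<in> carrier A \<Longrightarrow> Poly_Mapping.single a x \<in> K"
  by auto

lemma tone_closed: "tone \<in> K"
  by auto

lemma tmult_assoc: "f \<in> K \<Longrightarrow> g \<in> K \<Longrightarrow> h \<in> K \<Longrightarrow> f \<star> g \<star> h = f \<star> (g \<star> h)"
  using twisted_mult_assoc[OF is_group cocycle] by auto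

lemma tmult_tone: "f \<in> K \<Longrightarrow> tone \<star> f = f" "f \<in> K \<Longrightarrow> f \<star> tone = f"
  using twisted_mult_one[OF is_group cocycle] by auto

lemma tmult_diff_right: "f \<star> (g - h) = f \<star> g - f \<star> h"
  using twisted_mult_add_right[of A lam f "g - h" h] by (simp add: algebra_simps)

lemma tmult_diff_left: "(f - g) \<star> h = f \<star> h - g \<star> h"
  using twisted_mult_add_left[of A lam "f - g" g h] by (simp add: algebra_simps)

lemma lookup_tmult:
  "Poly_Mapping.lookup (f \<star> g) c =
     (\<Sum>a\<in>Poly_Mapping.keys f. \<Sum>b\<in>Poly_Mapping.keys g.
        if a \<otimes> b = c then Poly_Mapping.lookup f a * Poly_Mapping.lookup g b * lam a b else 0)"
  by (simp add: twisted_mult_def lookup_sum lookup_single when_def)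

text \<open>A unique product of the two supports receives a contribution from a single pair, and
  this contribution is nonzero because cocycle values are.\<close>

lemma tmult_nonzero:
  assumes "f \<in> K" "g \<in> K" "f \<noteq> 0" "g \<noteq> 0"
  shows "f \<star> g \<noteq> 0"
proof -
  let ?F = "Poly_Mapping.keys f" and ?G = "Poly_Mapping.keys g"
  have "?F \<noteq> {}" "?F \<subseteq> carrier A" "?G \<noteq> {}" "?G \<subseteq> carrier A"
    using assms by auto
  from torsion_free_unique_product[OF torsion_free finite_keys this(1,2) finite_keys this(3,4)]
  obtain s t where st: "s \<in> ?F" "t \<in> ?G"
    "\<And>s' t'. s' \<in> ?F \<Longrightarrow> t' \<in> ?G \<Longrightarrow> s' \<otimes> t' = s \<otimes> t \<Longrightarrow> s' = s \<and> t' = t"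
    by metis
  have "Poly_Mapping.lookup (f \<star> g) (s \<otimes> t) =
      (\<Sum>a\<in>?F. \<Sum>b\<in>?G. if b = t then
         (if a = s then Poly_Mapping.lookup f s * Poly_Mapping.lookup g t * lam s t else 0) else 0)"
    unfolding lookup_tmult
  proof (intro sum.cong refl)
    fix a b assume "a \<in> ?F" "b \<in> ?G"
    then show "(if a \<otimes> b = s \<otimes> t then Poly_Mapping.lookup f a * Poly_Mapping.lookup g b * lam a b else 0) =
      (if b = t then
         (if a = s then Poly_Mapping.lookup f s * Poly_Mapping.lookup g t * lam s t else 0) else 0)"
      using st(3)[of a b] by (cases "a = s \<and> b = t") auto
  qed
  also have "\<dots> = Poly_Mapping.lookup f s * Poly_Mapping.lookup g t * lam s t"
    using st(1,2) by simp
  also have "\<dots> \<noteq> 0"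
    using st(1,2) assms lam_nonzero by (auto simp: in_keys_iff subset_iff)
  finally show ?thesis by auto
qed

lemma tmult_cancel_right:
  assumes "f \<in> K" "g \<in> K" "h \<in> K" "h \<noteq> 0" "f \<star> h = g \<star> h"
  shows "f = g"
  using tmult_nonzero[of "f - g" h] K_diff[of f g] assms by (auto simp: tmult_diff_left)

text \<open>
  For a finite set \<open>T\<close> of group elements, \<open>(r, z) \<mapsto> f r - g z\<close> maps pairs supported on \<open>T\<close> to elements
  supported on \<open>E T\<close>, where \<open>E\<close> contains the supports of \<open>f\<close> and \<open>g\<close>. By the polynomial growth of
  the group, \<open>T\<close> can be chosen such that this map is not injective.
\<close>
lemma right_Ore:
  assumes f: "f \<in> K" and g: "g \<in> K" "g \<noteq> 0"
  obtains r z where "r \<in> K" "z \<in> K" "r \<noteq> 0" "f \<star> r = g \<star> z"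
proof -
  define E where "E = Poly_Mapping.keys f \<union> Poly_Mapping.keys g"
  have E: "finite E" "E \<subseteq> carrier A" using f g by (auto simp: E_def)
  from small_doubling[OF E] obtain T where
    T: "finite T" "T \<subseteq> carrier A" "card (E <#> T) < 2 * card T" by metis
  let ?s = "\<lambda>x c. Poly_Mapping.single x (c :: 'k)"
  \<comment> \<open>The unknowns are the coefficients of r (index True) and of z (index False) on T;
    the sign in -g makes f r = g z a homogeneous system.\<close>
  define M where "M i = Poly_Mapping.lookup ((if fst i then f else - g) \<star> ?s (snd i) 1)"
    for i :: "bool \<times> 'a"
  have "card (E <#> T) < card ((UNIV :: bool set) \<times> T)"
    using T(3) by (simp add: card_cartesian_product)
  moreover have "finite (E <#> T)" using E T by (simp add: set_mult_def)
  ultimately obtain c where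
    c: "\<exists>i\<in>(UNIV :: bool set) \<times> T. c i \<noteq> 0"
       "\<forall>y\<in>E <#> T. (\<Sum>i\<in>(UNIV :: bool set) \<times> T. c i * M i y) = 0"
    using homogeneous_system_nontrivial_solution[of "E <#> T" "(UNIV :: bool set) \<times> T" M] T(1)
    by auto
  define q where "q e = (\<Sum>x\<in>T. ?s x (c (e, x)))" for e
  have q_K: "q e \<in> K" for e
    unfolding q_def using T(2) by (intro K_sum K_single) auto
  have lookup_q: "Poly_Mapping.lookup (q e) x = c (e, x)" if "x \<in> T" for e x
    using that T(1) by (simp add: q_def lookup_sum lookup_single when_def)
  have scale: "Poly_Mapping.lookup (h \<star> ?s x a) y = a * Poly_Mapping.lookup (h \<star> ?s x 1) y" for h x a y
    by (cases "a = 0") (auto simp: lookup_tmult sum_distrib_left intro!: sum.cong)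
  have "f \<star> q True + (- g) \<star> q False = 0"
  proof (rule poly_mapping_eqI)
    fix y
    have "Poly_Mapping.lookup (f \<star> q True + (- g) \<star> q False) y =
        (\<Sum>e\<in>UNIV. \<Sum>x\<in>T. c (e, x) * M (e, x) y)"
      by (simp add: q_def lookup_add twisted_mult_sum_right lookup_sum scale[of _ _ "c _"] M_def
          UNIV_bool add.commute)
    also have "\<dots> = (\<Sum>i\<in>UNIV \<times> T. c i * M i y)"
      by (simp add: sum.cartesian_product)
    finally have "Poly_Mapping.lookup (f \<star> q True + (- g) \<star> q False) y =
        (\<Sum>i\<in>UNIV \<times> T. c i * M i y)" .
    \<comment> \<open>Outside E T the coefficients vanish identically, so the system imposes all the
      equations there are.\<close>
    moreover have "M i y = 0" if "i \<in> UNIV \<times> T" "y \<notin> E <#> T" for i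
    proof -
      have "Poly_Mapping.keys ((if fst i then f else - g) \<star> ?s (snd i) 1) \<subseteq> E <#> T"
        using keys_twisted_mult[of A lam "if fst i then f else - g" "?s (snd i) 1"] that(1)
        by (fastforce simp: set_mult_def E_def split: if_splits)
      then show ?thesis using that(2) by (auto simp: M_def in_keys_iff)
    qed
    ultimately show "Poly_Mapping.lookup (f \<star> q True + (- g) \<star> q False) y = Poly_Mapping.lookup 0 y"
      using c(2) by (cases "y \<in> E <#> T") auto
  qed
  moreover have "(- g) \<star> q False = - (g \<star> q False)"
    using tmult_diff_left[of 0 g "q False"] by simp
  ultimately have eq: "f \<star> q True = g \<star> q False" by simp
  \<comment> \<open>The solution is nontrivial, but it could still be concentrated in z; then g z =
    0 with g and z nonzero, impossible in a domain.\<close>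
  have "q True \<noteq> 0"
  proof
    assume 0: "q True = 0"
    then have "g \<star> q False = 0" using eq by simp
    then have "q False = 0" using tmult_nonzero[OF g(1) q_K g(2)] by blast
    with 0 lookup_q c(1) show False by (metis (full_types) lookup_zero mem_Times_iff prod.collapse)
  qed
  then show thesis using that[OF q_K q_K _ eq] by blast
qed

end

section \<open>Grading by degree and leading components\<close>

definition graded_component :: "('a \<Rightarrow> int) \<Rightarrow> int \<Rightarrow> ('a \<Rightarrow>\<^sub>0 'k::zero) \<Rightarrow> ('a \<Rightarrow>\<^sub>0 'k)" where
  "graded_component \<phi> n f = Poly_Mapping.mapp (\<lambda>a v. v when \<phi> a = n) f"

lemma lookup_graded_component:
  "Poly_Mapping.lookup (graded_component \<phi> n f) a = (Poly_Mapping.lookup f a when \<phi> a = n)"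
  by (simp add: graded_component_def lookup_mapp when_def in_keys_iff)

lemma keys_graded_component:
  "Poly_Mapping.keys (graded_component \<phi> n f) = {a \<in> Poly_Mapping.keys f. \<phi> a = n}"
  by (auto simp: in_keys_iff lookup_graded_component)

lemma graded_component_add:
  "graded_component \<phi> n (f + g) = graded_component \<phi> n f + graded_component \<phi> n (g :: 'a \<Rightarrow>\<^sub>0 'k::monoid_add)"
  by (rule poly_mapping_eqI) (simp add: lookup_graded_component lookup_add when_def)

lemma graded_component_eq_zero:
  "(\<And>a. a \<in> Poly_Mapping.keys f \<Longrightarrow> \<phi> a \<noteq> n) \<Longrightarrow> graded_component \<phi> n f = 0"
  by (rule poly_mapping_eqI) (auto simp: lookup_graded_component when_def in_keys_iff)

lemma graded_component_ident:
  "(\<And>a. a \<in> Poly_Mapping.keys f \<Longrightarrow> \<phi> a = n) \<Longrightarrow> graded_component \<phi> n f = f"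
  by (rule poly_mapping_eqI) (auto simp: lookup_graded_component when_def in_keys_iff)

lemma top_graded_component:
  assumes "f \<noteq> 0"
  obtains n where "graded_component \<phi> n f \<noteq> 0" "\<And>a. a \<in> Poly_Mapping.keys f \<Longrightarrow> \<phi> a \<le> n"
proof -
  have ne: "\<phi> ` Poly_Mapping.keys f \<noteq> {}" using assms by simp
  then have "Max (\<phi> ` Poly_Mapping.keys f) \<in> \<phi> ` Poly_Mapping.keys f" by (intro Max_in) auto
  then have "Poly_Mapping.keys (graded_component \<phi> (Max (\<phi> ` Poly_Mapping.keys f)) f) \<noteq> {}"
    by (auto simp: keys_graded_component)
  then show thesis by (intro that[of "Max (\<phi> ` Poly_Mapping.keys f)"]) auto
qed

context torsion_free_twisted_algebra
begin

lemma K_graded_component: "f \<in> K \<Longrightarrow> graded_component \<phi> n f \<in> K"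
  by (auto simp: keys_graded_component)

context
  fixes \<phi> :: "'a \<Rightarrow> int"
  assumes \<phi>_mult: "\<And>a b. a \<in> carrier A \<Longrightarrow> b \<in> carrier A \<Longrightarrow> \<phi> (a \<otimes> b) = \<phi> a + \<phi> b"
begin

lemma keys_tmult_degree:
  assumes "f \<in> K" "g \<in> K" "c \<in> Poly_Mapping.keys (f \<star> g)"
  obtains a b where "a \<in> Poly_Mapping.keys f" "b \<in> Poly_Mapping.keys g" "\<phi> c = \<phi> a + \<phi> b"
proof -
  obtain a b where "a \<in> Poly_Mapping.keys f" "b \<in> Poly_Mapping.keys g" "c = a \<otimes> b"
    using keys_twisted_mult[of A lam f g] assms(3) by blast
  then show thesis using assms(1,2) \<phi>_mult by (intro that[of a b]) auto
qed

text \<open>Only the product of the two components reaches degree n + m, since in every other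
  product one factor has strictly smaller degree. The bounds n and m need not be attained.\<close>

lemma top_component_tmult:
  assumes f: "f \<in> K" "\<And>a. a \<in> Poly_Mapping.keys f \<Longrightarrow> \<phi> a \<le> n"
    and g: "g \<in> K" "\<And>a. a \<in> Poly_Mapping.keys g \<Longrightarrow> \<phi> a \<le> m"
  shows "graded_component \<phi> (n + m) (f \<star> g) = graded_component \<phi> n f \<star> graded_component \<phi> m g"
proof -
  let ?f = "graded_component \<phi> n f" and ?g = "graded_component \<phi> m g"
  have rest: "\<phi> a < n" if "a \<in> Poly_Mapping.keys (h - graded_component \<phi> n h)"
    "\<And>a. a \<in> Poly_Mapping.keys h \<Longrightarrow> \<phi> a \<le> n" for h :: "'a \<Rightarrow>\<^sub>0 'k" and a n
    using that by (auto simp: in_keys_iff lookup_minus lookup_graded_component when_def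
        order.strict_iff_order split: if_splits)
  have "f \<star> g = ?f \<star> ?g + (?f \<star> (g - ?g) + (f - ?f) \<star> g)"
    by (simp add: tmult_diff_left tmult_diff_right)
  moreover have "graded_component \<phi> (n + m) (?f \<star> ?g) = ?f \<star> ?g"
    by (rule graded_component_ident)
      (erule keys_tmult_degree[OF K_graded_component[OF f(1)] K_graded_component[OF g(1)]],
        auto simp: keys_graded_component)
  moreover have "graded_component \<phi> (n + m) (?f \<star> (g - ?g)) = 0"
  proof (rule graded_component_eq_zero)
    fix c assume "c \<in> Poly_Mapping.keys (?f \<star> (g - ?g))"
    then obtain a b where "a \<in> Poly_Mapping.keys ?f" "b \<in> Poly_Mapping.keys (g - ?g)" "\<phi> c = \<phi> a + \<phi> b"
      using keys_tmult_degree[OF K_graded_component[OF f(1)] K_diff[OF g(1) K_graded_component[OF g(1)]]]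
      by metis
    with rest[of b g m] g(2) show "\<phi> c \<noteq> n + m" by (auto simp: keys_graded_component)
  qed
  moreover have "graded_component \<phi> (n + m) ((f - ?f) \<star> g) = 0"
  proof (rule graded_component_eq_zero)
    fix c assume "c \<in> Poly_Mapping.keys ((f - ?f) \<star> g)"
    then obtain a b where "a \<in> Poly_Mapping.keys (f - ?f)" "b \<in> Poly_Mapping.keys g" "\<phi> c = \<phi> a + \<phi> b"
      using keys_tmult_degree[OF K_diff[OF f(1) K_graded_component[OF f(1)]] g(1)] by metis
    with rest[of a f n] f(2) g(2)[of b] show "\<phi> c \<noteq> n + m" by force
  qed
  ultimately show ?thesis by (simp add: graded_component_add)
qed

lemma top_component_tmult_nonzero:
  assumes "f \<in> K" "\<And>a. a \<in> Poly_Mapping.keys f \<Longrightarrow> \<phi> a \<le> n" "graded_component \<phi> n f \<noteq> 0"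
    and "g \<in> K" "\<And>a. a \<in> Poly_Mapping.keys g \<Longrightarrow> \<phi> a \<le> m" "graded_component \<phi> m g \<noteq> 0"
  shows "graded_component \<phi> (n + m) (f \<star> g) \<noteq> 0"
    and "\<And>c. c \<in> Poly_Mapping.keys (f \<star> g) \<Longrightarrow> \<phi> c \<le> n + m"
proof -
  show "graded_component \<phi> (n + m) (f \<star> g) \<noteq> 0"
    by (simp only: top_component_tmult[OF assms(1,2,4,5)])
      (rule tmult_nonzero[OF K_graded_component[OF assms(1)] K_graded_component[OF assms(4)] assms(3,6)])
  fix c assume "c \<in> Poly_Mapping.keys (f \<star> g)"
  then obtain a b where "a \<in> Poly_Mapping.keys f" "b \<in> Poly_Mapping.keys g" "\<phi> c = \<phi> a + \<phi> b"
    using keys_tmult_degree[OF assms(1,4)] by metis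
  with assms(2,5) show "\<phi> c \<le> n + m" by force
qed

lemma top_degree_unique:
  assumes "graded_component \<phi> n f \<noteq> 0" "\<And>a. a \<in> Poly_Mapping.keys f \<Longrightarrow> \<phi> a \<le> n"
    and "graded_component \<phi> m f \<noteq> 0" "\<And>a. a \<in> Poly_Mapping.keys f \<Longrightarrow> \<phi> a \<le> m"
  shows "n = m"
proof -
  have "n \<le> m" if "graded_component \<phi> n f \<noteq> 0" "\<And>a. a \<in> Poly_Mapping.keys f \<Longrightarrow> \<phi> a \<le> m"
    for n m
    using that graded_component_eq_zero[of f \<phi> n] by force
  then show ?thesis using assms by (meson order.antisym)
qed

text \<open>
  In the skew field of fractions, \<open>s b\<^sup>-\<^sup>1 = t p\<^sup>-\<^sup>1\<close>. As the leading coefficient of \<open>p\<close> is a unit, the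
  leading coefficient of this fraction lies in the algebra; splitting it off lowers the number of
  degrees in \<open>s\<close>.
\<close>
lemma divides_of_monic_fraction:
  assumes b: "b \<in> K" "b \<noteq> 0" "\<And>a. a \<in> Poly_Mapping.keys b \<Longrightarrow> \<phi> a = 0"
    and p: "p \<in> K" "\<And>a. a \<in> Poly_Mapping.keys p \<Longrightarrow> \<phi> a \<le> d"
    and y: "y \<in> carrier A" "graded_component \<phi> d p = Poly_Mapping.single y 1"
    and r: "r \<in> K" "r \<noteq> 0" and z: "z \<in> K" and pr: "p \<star> r = b \<star> z"
    and st: "s \<in> K" "t \<in> K" "t \<star> r = s \<star> z"
  shows "\<exists>c\<in>K. s = c \<star> b"
  using st
proof (induction "card (\<phi> ` Poly_Mapping.keys s)" arbitrary: s t rule: less_induct)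
  case less
  note s = less.prems(1) and t = less.prems(2) and eq = less.prems(3)
  show ?case
  proof (cases "s = 0")
    case True
    then show ?thesis by (intro bexI[of _ 0]) auto
  next
    case False
    have p0: "graded_component \<phi> d p \<noteq> 0"
      using y(2) by (metis lookup_single_eq lookup_zero zero_neq_one)
    then have "p \<noteq> 0" by (metis graded_component_eq_zero keys_zero empty_iff)
    \<comment> \<open>All four elements in t r = s z must be nonzero in order to have leading
      components; for z and t this comes from p r = b z and from t r = s z.\<close>
    then have "b \<star> z \<noteq> 0" using tmult_nonzero[OF p(1) r(1)] r(2) pr by metis
    then have "z \<noteq> 0" by auto
    then have "t \<star> r \<noteq> 0" using tmult_nonzero[OF s z False] eq by metis
    then have "t \<noteq> 0" by auto
    obtain N where N: "graded_component \<phi> N s \<noteq> 0" "\<And>a. a \<in> Poly_Mapping.keys s \<Longrightarrow> \<phi> a \<le> N"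
      using top_graded_component[OF False] by metis
    obtain \<tau> where \<tau>: "graded_component \<phi> \<tau> t \<noteq> 0" "\<And>a. a \<in> Poly_Mapping.keys t \<Longrightarrow> \<phi> a \<le> \<tau>"
      using top_graded_component[OF \<open>t \<noteq> 0\<close>] by metis
    obtain \<rho> where \<rho>: "graded_component \<phi> \<rho> r \<noteq> 0" "\<And>a. a \<in> Poly_Mapping.keys r \<Longrightarrow> \<phi> a \<le> \<rho>"
      using top_graded_component[OF r(2)] by metis
    obtain \<zeta> where \<zeta>: "graded_component \<phi> \<zeta> z \<noteq> 0" "\<And>a. a \<in> Poly_Mapping.keys z \<Longrightarrow> \<phi> a \<le> \<zeta>"
      using top_graded_component[OF \<open>z \<noteq> 0\<close>] by metis
    let ?s = "graded_component \<phi> N s" and ?t = "graded_component \<phi> \<tau> t"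
      and ?r = "graded_component \<phi> \<rho> r" and ?z = "graded_component \<phi> \<zeta> z" and ?p = "Poly_Mapping.single y (1::'k)"
    have K: "?s \<in> K" "?t \<in> K" "?r \<in> K" "?z \<in> K" "?p \<in> K"
      using K_graded_component s t r(1) z K_single[OF y(1)] by blast+
    have b_comp: "graded_component \<phi> 0 b = b"
      using b(3) by (rule graded_component_ident)
    have b_le: "\<And>a. a \<in> Poly_Mapping.keys b \<Longrightarrow> \<phi> a \<le> 0" using b(3) by simp
    have b0: "graded_component \<phi> 0 b \<noteq> 0" using b_comp b(2) by simp
    \<comment> \<open>Equal elements have equal top degrees, so both equations pass to leading
      components. The summand 0 is the degree of b, which is its own leading component.\<close>
    have d1: "d + \<rho> = 0 + \<zeta>"
      using top_degree_unique[of "d + \<rho>" "p \<star> r" "0 + \<zeta>"]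
        top_component_tmult_nonzero[OF p p0 r(1) \<rho>(2,1)]
        top_component_tmult_nonzero[OF b(1) b_le b0 z \<zeta>(2,1)] pr by simp
    have d2: "\<tau> + \<rho> = N + \<zeta>"
      using top_degree_unique[of "\<tau> + \<rho>" "t \<star> r" "N + \<zeta>"]
        top_component_tmult_nonzero[OF t \<tau>(2,1) r(1) \<rho>(2,1)]
        top_component_tmult_nonzero[OF s N(2,1) z \<zeta>(2,1)] eq by simp
    have e1: "?p \<star> ?r = b \<star> ?z"
      using top_component_tmult[OF p r(1) \<rho>(2)] top_component_tmult[OF b(1) b_le z \<zeta>(2)] d1 pr y(2)
        b_comp by simp
    have e2: "?t \<star> ?r = ?s \<star> ?z"
      using top_component_tmult[OF t \<tau>(2) r(1) \<rho>(2)] top_component_tmult[OF s N(2) z \<zeta>(2)] d2 eq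
      by simp
    \<comment> \<open>The inverse of the basis element of y; the factor lam \<one> \<one> is there
      because the cocycle is not normalised.\<close>
    define v where "v = Poly_Mapping.single (inv y) (inverse (lam (inv y) y * lam \<one> \<one>))"
    have v: "v \<in> K" using y(1) by (auto simp: v_def)
    have vp: "v \<star> ?p = tone"
      using y(1) lam_nonzero[of "inv y" y] lam_nonzero[of \<one> \<one>] by (simp add: v_def field_simps)
    define c where "c = ?t \<star> v"
    have c: "c \<in> K" unfolding c_def by (rule tmult_closed[OF K(2) v])
    have cp: "c \<star> ?p = ?t"
      unfolding c_def using tmult_assoc[OF K(2) v K(5)] vp tmult_tone(2)[OF K(2)] by simp
    have "(c \<star> b) \<star> ?z = c \<star> (?p \<star> ?r)" using tmult_assoc[OF c b(1) K(4)] e1 by simp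
    also have "\<dots> = ?s \<star> ?z" using tmult_assoc[OF c K(5) K(3)] cp e2 by simp
    finally have cb: "c \<star> b = ?s"
      using tmult_cancel_right[OF tmult_closed[OF c b(1)] K(1) K(4)] \<zeta>(1) by blast
    \<comment> \<open>Subtracting c from the fraction changes the numerators s and t by c b and c p,
      so the hypothesis on s and t persists.\<close>
    have "(t - c \<star> p) \<star> r = (s - ?s) \<star> z"
      unfolding tmult_diff_left eq tmult_assoc[OF c p(1) r(1)] pr
        tmult_assoc[OF c b(1) z, symmetric] cb ..
    moreover have "card (\<phi> ` Poly_Mapping.keys (s - ?s)) < card (\<phi> ` Poly_Mapping.keys s)"
    proof (rule psubset_card_mono)
      have keys: "Poly_Mapping.keys (s - ?s) = {a \<in> Poly_Mapping.keys s. \<phi> a \<noteq> N}"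
        by (auto simp: in_keys_iff lookup_minus lookup_graded_component when_def)
      have "N \<in> \<phi> ` Poly_Mapping.keys s"
        using N(1) graded_component_eq_zero[of s \<phi> N] by blast
      moreover have "N \<notin> \<phi> ` {a \<in> Poly_Mapping.keys s. \<phi> a \<noteq> N}" by auto
      ultimately show "\<phi> ` Poly_Mapping.keys (s - ?s) \<subset> \<phi> ` Poly_Mapping.keys s"
        unfolding keys by blast
    qed simp
    ultimately obtain c' where c': "c' \<in> K" "s - ?s = c' \<star> b"
      using less.hyps[of "s - ?s" "t - c \<star> p"] K_diff[OF s K(1)]
        K_diff[OF t tmult_closed[OF c p(1)]] by blast
    then have "s = (c' + c) \<star> b"
      using cb by (simp add: twisted_mult_add_left algebra_simps)
    then show ?thesis using K_add[OF c'(1) c] by blast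
  qed
qed

end

end

section \<open>Right modules\<close>

context right_module
begin

lemma smult_zero_right: "a \<in> carrier R \<Longrightarrow> a \<odot>\<^bsub>M\<^esub> \<zero>\<^bsub>M\<^esub> = \<zero>\<^bsub>M\<^esub>"
  using smult_r_distr[of a "\<zero>\<^bsub>M\<^esub>" "\<zero>\<^bsub>M\<^esub>"] smult_closed[of a "\<zero>\<^bsub>M\<^esub>"]
  by (metis M.zero_closed M.l_zero M.r_zero M.add.l_cancel)

lemma smult_zero_left: "x \<in> carrier M \<Longrightarrow> \<zero> \<odot>\<^bsub>M\<^esub> x = \<zero>\<^bsub>M\<^esub>"
  using smult_l_distr[of \<zero> \<zero> x] smult_closed[of \<zero> x]
  by (metis M.zero_closed M.r_zero M.add.l_cancel R.zero_closed R.l_zero)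

lemma smult_minus_left: "a \<in> carrier R \<Longrightarrow> x \<in> carrier M \<Longrightarrow> (\<ominus> a) \<odot>\<^bsub>M\<^esub> x = \<ominus>\<^bsub>M\<^esub> (a \<odot>\<^bsub>M\<^esub> x)"
  using smult_l_distr[of "\<ominus> a" a x] smult_zero_left[of x]
  by (metis M.minus_equality R.add.inv_closed R.l_neg smult_closed)

end

lemma right_moduleI:
  assumes "ring R"
    and "\<And>x y. \<lbrakk>x \<in> carrier M; y \<in> carrier M\<rbrakk> \<Longrightarrow> x \<oplus>\<^bsub>M\<^esub> y \<in> carrier M"
    and "\<zero>\<^bsub>M\<^esub> \<in> carrier M"
    and "\<And>x y z. \<lbrakk>x \<in> carrier M; y \<in> carrier M; z \<in> carrier M\<rbrakk> \<Longrightarrow>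
            (x \<oplus>\<^bsub>M\<^esub> y) \<oplus>\<^bsub>M\<^esub> z = x \<oplus>\<^bsub>M\<^esub> (y \<oplus>\<^bsub>M\<^esub> z)"
    and "\<And>x y. \<lbrakk>x \<in> carrier M; y \<in> carrier M\<rbrakk> \<Longrightarrow> x \<oplus>\<^bsub>M\<^esub> y = y \<oplus>\<^bsub>M\<^esub> x"
    and "\<And>x. x \<in> carrier M \<Longrightarrow> \<zero>\<^bsub>M\<^esub> \<oplus>\<^bsub>M\<^esub> x = x"
    and "\<And>x. x \<in> carrier M \<Longrightarrow> \<exists>y\<in>carrier M. y \<oplus>\<^bsub>M\<^esub> x = \<zero>\<^bsub>M\<^esub>"
    and "\<And>a x. \<lbrakk>a \<in> carrier R; x \<in> carrier M\<rbrakk> \<Longrightarrow> a \<odot>\<^bsub>M\<^esub> x \<in> carrier M"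
    and "\<And>a b x. \<lbrakk>a \<in> carrier R; b \<in> carrier R; x \<in> carrier M\<rbrakk> \<Longrightarrow>
            (a \<oplus>\<^bsub>R\<^esub> b) \<odot>\<^bsub>M\<^esub> x = a \<odot>\<^bsub>M\<^esub> x \<oplus>\<^bsub>M\<^esub> b \<odot>\<^bsub>M\<^esub> x"
    and "\<And>a x y. \<lbrakk>a \<in> carrier R; x \<in> carrier M; y \<in> carrier M\<rbrakk> \<Longrightarrow>
            a \<odot>\<^bsub>M\<^esub> (x \<oplus>\<^bsub>M\<^esub> y) = a \<odot>\<^bsub>M\<^esub> x \<oplus>\<^bsub>M\<^esub> a \<odot>\<^bsub>M\<^esub> y"
    and "\<And>a b x. \<lbrakk>a \<in> carrier R; b \<in> carrier R; x \<in> carrier M\<rbrakk> \<Longrightarrow>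
            (a \<otimes>\<^bsub>R\<^esub> b) \<odot>\<^bsub>M\<^esub> x = b \<odot>\<^bsub>M\<^esub> (a \<odot>\<^bsub>M\<^esub> x)"
    and "\<And>x. x \<in> carrier M \<Longrightarrow> \<one>\<^bsub>R\<^esub> \<odot>\<^bsub>M\<^esub> x = x"
  shows "right_module R M"
  by (intro right_module.intro abelian_groupI right_module_axioms.intro assms)

lemma right_module_hom_closed:
  "h \<in> right_module_hom R M N \<Longrightarrow> x \<in> carrier M \<Longrightarrow> h x \<in> carrier N"
  by (auto simp: right_module_hom_def)

lemma right_module_hom_add:
  "h \<in> right_module_hom R M N \<Longrightarrow> x \<in> carrier M \<Longrightarrow> y \<in> carrier M \<Longrightarrow>
     h (x \<oplus>\<^bsub>M\<^esub> y) = h x \<oplus>\<^bsub>N\<^esub> h y"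
  by (auto simp: right_module_hom_def)

lemma right_module_hom_smult:
  "h \<in> right_module_hom R M N \<Longrightarrow> r \<in> carrier R \<Longrightarrow> x \<in> carrier M \<Longrightarrow>
     h (r \<odot>\<^bsub>M\<^esub> x) = r \<odot>\<^bsub>N\<^esub> h x"
  by (auto simp: right_module_hom_def)

lemma right_module_hom_zero:
  assumes "right_module R M" "right_module R N" "h \<in> right_module_hom R M N"
  shows "h \<zero>\<^bsub>M\<^esub> = \<zero>\<^bsub>N\<^esub>"
proof -
  interpret M: right_module R M by fact
  interpret N: right_module R N by fact
  show ?thesis
    by (metis M.smult_zero_left N.smult_zero_left M.M.zero_closed M.R.zero_closed
        right_module_hom_closed[OF assms(3)] right_module_hom_smult[OF assms(3)])
qed

lemma right_module_hom_comp:
  assumes "g \<in> right_module_hom R M N" "h \<in> right_module_hom R N L"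
  shows "(\<lambda>x. h (g x)) \<in> right_module_hom R M L"
  using assms unfolding right_module_hom_def by (auto simp: Pi_iff)

lemma right_module_hom_plus:
  assumes "right_module R N" "g \<in> right_module_hom R M N" "h \<in> right_module_hom R M N"
  shows "(\<lambda>x. g x \<oplus>\<^bsub>N\<^esub> h x) \<in> right_module_hom R M N"
proof -
  interpret N: right_module R N by fact
  show ?thesis
    using assms(2,3) unfolding right_module_hom_def
    by (auto simp: Pi_iff N.smult_r_distr N.M.add.m_ac)
qed

text \<open>L has to agree with N only on its own carrier, so that it may be a submodule of N such
  as the image of h.\<close>

lemma right_module_hom_inv:
  assumes M: "right_module R M" and h: "h \<in> right_module_hom R M N"
    and inj: "inj_on h (carrier M)" and img: "carrier L \<subseteq> h ` carrier M"
    and closed: "\<And>x y. \<lbrakk>x \<in> carrier L; y \<in> carrier L\<rbrakk> \<Longrightarrow> x \<oplus>\<^bsub>L\<^esub> y = x \<oplus>\<^bsub>N\<^esub> y"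
      "\<And>a x. \<lbrakk>a \<in> carrier R; x \<in> carrier L\<rbrakk> \<Longrightarrow> a \<odot>\<^bsub>L\<^esub> x = a \<odot>\<^bsub>N\<^esub> x"
  shows "inv_into (carrier M) h \<in> right_module_hom R L M"
proof -
  interpret M: right_module R M by fact
  have inv: "inv_into (carrier M) h x \<in> carrier M" "h (inv_into (carrier M) h x) = x"
    if "x \<in> carrier L" for x
    using that img by (auto intro: inv_into_into f_inv_into_f)
  show ?thesis
    unfolding right_module_hom_def
  proof (intro CollectI conjI ballI Pi_I)
    fix x y assume "x \<in> carrier L" "y \<in> carrier L"
    then show "inv_into (carrier M) h (x \<oplus>\<^bsub>L\<^esub> y) =
        inv_into (carrier M) h x \<oplus>\<^bsub>M\<^esub> inv_into (carrier M) h y"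
      by (intro inv_into_f_eq[OF inj]) (simp_all add: inv closed right_module_hom_add[OF h])
  next
    fix a x assume "a \<in> carrier R" "x \<in> carrier L"
    then show "inv_into (carrier M) h (a \<odot>\<^bsub>L\<^esub> x) = a \<odot>\<^bsub>M\<^esub> inv_into (carrier M) h x"
      by (intro inv_into_f_eq[OF inj])
        (simp_all add: inv closed right_module_hom_smult[OF h] M.smult_closed)
  qed (use inv in auto)
qed

text \<open>Brings a module of any type into the universe in which projectivity is tested. The
  multiplicative fields are left undefined because the module record extends the ring
  record.\<close>

definition transport_module ::
    "('u \<Rightarrow> 'v) \<Rightarrow> ('r, 'u, 'e) module_scheme \<Rightarrow> ('r, 'v) module" where
  "transport_module \<iota> M =
     \<lparr>carrier = \<iota> ` carrier M,
      monoid.mult = (\<lambda>_ _. undefined),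
      monoid.one = undefined,
      ring.zero = \<iota> \<zero>\<^bsub>M\<^esub>,
      ring.add = (\<lambda>x y. \<iota> (inv_into (carrier M) \<iota> x \<oplus>\<^bsub>M\<^esub> inv_into (carrier M) \<iota> y)),
      module.smult = (\<lambda>a x. \<iota> (a \<odot>\<^bsub>M\<^esub> inv_into (carrier M) \<iota> x))\<rparr>"

lemma transport_module:
  assumes M: "right_module R M" and inj: "inj_on \<iota> (carrier M)"
  shows "right_module R (transport_module \<iota> M)"
    and "\<iota> \<in> right_module_hom R M (transport_module \<iota> M)"
    and "inv_into (carrier M) \<iota> \<in> right_module_hom R (transport_module \<iota> M) M"
proof -
  interpret M: right_module R M by fact
  note [simp] = inv_into_f_f[OF inj] M.smult_closed
  show "right_module R (transport_module \<iota> M)"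
  proof (rule right_moduleI)
    fix x assume "x \<in> carrier (transport_module \<iota> M)"
    then show "\<exists>y\<in>carrier (transport_module \<iota> M).
        y \<oplus>\<^bsub>transport_module \<iota> M\<^esub> x = \<zero>\<^bsub>transport_module \<iota> M\<^esub>"
      by (auto simp: transport_module_def M.M.l_neg intro!: bexI[of _ "\<ominus>\<^bsub>M\<^esub> _"])
  qed (auto simp: transport_module_def M.R.ring_axioms M.M.a_assoc M.smult_l_distr M.smult_r_distr
      M.smult_right_action M.smult_one M.M.a_ac)
  show hom: "\<iota> \<in> right_module_hom R M (transport_module \<iota> M)"
    by (auto simp: right_module_hom_def transport_module_def)
  show "inv_into (carrier M) \<iota> \<in> right_module_hom R (transport_module \<iota> M) M"
    by (rule right_module_hom_inv[OF M hom inj]) (auto simp: transport_module_def)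
qed

definition right_ideal_module :: "('r, 'e) ring_scheme \<Rightarrow> 'r set \<Rightarrow> ('r, 'r) module" where
  "right_ideal_module R I =
     \<lparr>carrier = I, monoid.mult = (\<lambda>_ _. undefined), monoid.one = undefined,
      ring.zero = \<zero>\<^bsub>R\<^esub>, ring.add = (\<oplus>\<^bsub>R\<^esub>), module.smult = (\<lambda>a x. x \<otimes>\<^bsub>R\<^esub> a)\<rparr>"

definition annihilator ::
    "('r, 'e) ring_scheme \<Rightarrow> ('r, 'u, 'f) module_scheme \<Rightarrow> 'u \<Rightarrow> 'r set" where
  "annihilator R M u = {a \<in> carrier R. a \<odot>\<^bsub>M\<^esub> u = \<zero>\<^bsub>M\<^esub>}"

lemma right_module_regular:
  assumes "ring R"
  shows "right_module R (right_ideal_module R (carrier R))"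
proof -
  interpret ring R by fact
  show ?thesis
    by (rule right_moduleI)
      (auto simp: right_ideal_module_def assms a_ac l_distr r_distr m_assoc
        intro!: bexI[of _ "\<ominus>\<^bsub>R\<^esub> _"] r_neg)
qed

lemma right_module_annihilator:
  assumes "right_module R M" "u \<in> carrier M"
  shows "right_module R (right_ideal_module R (annihilator R M u))"
proof -
  interpret right_module R M by fact
  show ?thesis
  proof (rule right_moduleI)
    fix x assume "x \<in> carrier (right_ideal_module R (annihilator R M u))"
    then have "x \<in> carrier R" "\<ominus>\<^bsub>R\<^esub> x \<in> annihilator R M u"
      using assms(2) by (auto simp: right_ideal_module_def annihilator_def smult_minus_left)
    then show "\<exists>y\<in>carrier (right_ideal_module R (annihilator R M u)).
        y \<oplus>\<^bsub>right_ideal_module R (annihilator R M u)\<^esub> x = \<zero>\<^bsub>right_ideal_module R (annihilator R M u)\<^esub>"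
      by (intro bexI[of _ "\<ominus>\<^bsub>R\<^esub> x"]) (auto simp: right_ideal_module_def R.l_neg)
  qed (use assms(2) in \<open>auto simp: right_ideal_module_def annihilator_def R.ring_axioms R.a_ac
        R.l_distr R.r_distr R.m_assoc smult_l_distr smult_right_action smult_zero_left
        smult_zero_right\<close>)
qed

lemma smult_right_module_hom:
  assumes "right_module R M" "u \<in> carrier M" "I \<subseteq> carrier R"
  shows "(\<lambda>a. a \<odot>\<^bsub>M\<^esub> u) \<in> right_module_hom R (right_ideal_module R I) M"
proof -
  interpret right_module R M by fact
  show ?thesis
    using assms(2,3)
    by (auto simp: right_module_hom_def right_ideal_module_def smult_closed smult_l_distr
        smult_right_action subset_iff)
qed

section \<open>Cyclic modules of projective dimension at most one\<close>

text \<open>Frees the lifting property from the universe: V and W may live in other types as long as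
  their carriers inject into it.\<close>

lemma projective_right_module_lift:
  fixes \<iota> :: "'v \<Rightarrow> 't" and \<kappa> :: "'w \<Rightarrow> 't"
  assumes P: "projective_right_module R (P :: ('r, 't) module)"
    and V: "right_module R V" "inj_on \<iota> (carrier V)" and W: "right_module R W" "inj_on \<kappa> (carrier W)"
    and p: "p \<in> right_module_hom R V W" "p ` carrier V = carrier W"
    and f: "f \<in> right_module_hom R P W"
  obtains g where "g \<in> right_module_hom R P V" "\<And>x. x \<in> carrier P \<Longrightarrow> p (g x) = f x"
proof -
  let ?V = "transport_module \<iota> V" and ?W = "transport_module \<kappa> W"
  let ?i = "inv_into (carrier V) \<iota>"
  note V' = transport_module[OF V] and W' = transport_module[OF W]
  define q where "q = (\<lambda>x. \<kappa> (p (?i x)))"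
  have q: "q \<in> right_module_hom R ?V ?W"
    unfolding q_def
    by (rule right_module_hom_comp[OF right_module_hom_comp[OF V'(3) p(1)] W'(2)])
  have "q ` carrier ?V = \<kappa> ` p ` ?i ` \<iota> ` carrier V"
    by (simp add: q_def image_image transport_module_def)
  also have "?i ` \<iota> ` carrier V = carrier V"
    using V(2) by (simp add: image_image)
  finally have q_surj: "q ` carrier ?V = carrier ?W"
    by (simp add: p(2) transport_module_def)
  have "(\<lambda>x. \<kappa> (f x)) \<in> right_module_hom R P ?W"
    by (rule right_module_hom_comp[OF f W'(2)])
  then obtain g where g: "g \<in> right_module_hom R P ?V" "\<forall>x\<in>carrier P. q (g x) = \<kappa> (f x)"
    using P V'(1) W'(1) q q_surj unfolding projective_right_module_def by blast
  show thesis
  proof (rule that[of "\<lambda>x. ?i (g x)"])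
    show hom: "(\<lambda>x. ?i (g x)) \<in> right_module_hom R P V"
      by (rule right_module_hom_comp[OF g(1) V'(3)])
    fix x assume x: "x \<in> carrier P"
    have "p (?i (g x)) \<in> carrier W" "f x \<in> carrier W"
      using right_module_hom_closed[OF p(1) right_module_hom_closed[OF hom x]]
        right_module_hom_closed[OF f x] by auto
    with g(2) x W(2) show "p (?i (g x)) = f x"
      by (auto simp: q_def dest: inj_onD)
  qed
qed

lemma projective_resolution_le_one:
  assumes "right_global_dimension TYPE('m) R \<le> 1"
    and "right_module R (M :: ('r, 'r \<times> 'm) module)"
  obtains n C d where "C 0 = M" "projective_resolution R n C d" "n \<le> 1"
proof -
  let ?N = "{n. \<exists>C d. C 0 = M \<and> projective_resolution R n C d}"
  have "projective_dimension R M \<le> 1"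
    using assms by (auto simp: right_global_dimension_def SUP_le_iff)
  \<comment> \<open>The bound is made strict so that an element of the set below it can be
    extracted.\<close>
  then have "(INF n\<in>?N. enat n) < enat 2"
    by (auto simp: projective_dimension_def one_enat_def intro: le_less_trans)
  then obtain n where "n \<in> ?N" "enat n < enat 2"
    unfolding INF_less_iff by blast
  then show thesis
    using that by fastforce
qed

text \<open>
  This is Schanuel's lemma for the given resolution and \<open>0 \<rightarrow> I \<rightarrow> R \<rightarrow> U \<rightarrow> 0\<close>, where \<open>I\<close> is the
  annihilator of the generator \<open>u\<close>.
\<close>
lemma annihilator_section:
  fixes U :: "('r, 'u, 'e) module_scheme" and \<iota> :: "'v \<Rightarrow> 'r \<times> 'm"
  assumes dim: "right_global_dimension TYPE('m) R \<le> 1"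
    and U: "right_module R U" "u \<in> carrier U" "(\<lambda>a. a \<odot>\<^bsub>U\<^esub> u) ` carrier R = carrier U"
    and V: "right_module R V" "inj_on \<iota> (carrier V)"
    and p: "p \<in> right_module_hom R V (right_ideal_module R (annihilator R U u))"
      "p ` carrier V = annihilator R U u"
  obtains h where "h \<in> right_module_hom R (right_ideal_module R (annihilator R U u)) V"
    and "\<And>y. y \<in> annihilator R U u \<Longrightarrow> p (h y) = y"
proof -
  interpret U: right_module R U by fact
  interpret V: right_module R V by fact
  let ?I = "annihilator R U u"
  let ?\<rho> = "\<lambda>a :: 'r. (a, undefined :: 'm)"
  let ?RR = "right_ideal_module R (carrier R)" and ?II = "right_ideal_module R ?I"
  \<comment> \<open>The carrier of U may have any type; as U is cyclic, choosing for each element a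
    ring element that produces it embeds U into the universe.\<close>
  define \<eta> where "\<eta> = (\<lambda>x. ?\<rho> (inv_into (carrier R) (\<lambda>a. a \<odot>\<^bsub>U\<^esub> u) x))"
  have \<eta>: "inj_on \<eta> (carrier U)"
    using inj_on_inv_into[of "carrier U" "\<lambda>a. a \<odot>\<^bsub>U\<^esub> u" "carrier R"] U(3)
    by (auto simp: \<eta>_def inj_on_def)
  have I_R: "?I \<subseteq> carrier R"
    by (auto simp: annihilator_def)
  let ?U = "transport_module \<eta> U"
  note U' = transport_module[OF U(1) \<eta>]
  obtain n C d where C: "C 0 = ?U" "projective_resolution R n C d" "n \<le> 1"
    using projective_resolution_le_one[OF dim U'(1)] by metis
  define P0 where "P0 = C 1"
  have P0: "projective_right_module R P0" and d0: "d 0 \<in> right_module_hom R P0 ?U"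
    and d0_surj: "d 0 ` carrier P0 = carrier ?U"
    using C by (auto simp: projective_resolution_def P0_def)
  interpret P0: right_module R P0
    using P0 by (simp add: projective_right_module_def)
  define \<delta> where "\<delta> = (\<lambda>x. inv_into (carrier U) \<eta> (d 0 x))"
  have \<delta>: "\<delta> \<in> right_module_hom R P0 U"
    unfolding \<delta>_def by (rule right_module_hom_comp[OF d0 U'(3)])
  have d0_\<delta>: "d 0 x = \<eta> (\<delta> x)" if "x \<in> carrier P0" for x
    using right_module_hom_closed[OF d0 that]
    by (auto simp: \<delta>_def transport_module_def f_inv_into_f)
  obtain v where v: "v \<in> carrier P0" "d 0 v = \<eta> u"
    using d0_surj U(2) by (metis (no_types, lifting) imageE imageI partial_object.select_convs(1) transport_module_def)
  have \<delta>v: "\<delta> v = u"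
    using v U(2) \<eta> by (simp add: \<delta>_def)
  have "inj_on ?\<rho> (carrier ?RR)" "inj_on ?\<rho> (carrier ?II)"
    by (auto simp: inj_on_def)
  note inj = this
  obtain \<beta> where \<beta>: "\<beta> \<in> right_module_hom R P0 ?RR"
    and \<beta>_eq: "\<And>x. x \<in> carrier P0 \<Longrightarrow> \<beta> x \<odot>\<^bsub>U\<^esub> u = \<delta> x"
    using projective_right_module_lift[OF P0 right_module_regular[OF U.R.ring_axioms] inj(1) U(1) \<eta>
        smult_right_module_hom[OF U(1,2) subset_refl] _ \<delta>] U(3)
    by (auto simp: right_ideal_module_def)
  have \<beta>_closed: "\<beta> x \<in> carrier R" if "x \<in> carrier P0" for x
    using right_module_hom_closed[OF \<beta> that] by (simp add: right_ideal_module_def)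
  \<comment> \<open>Since v lies over u and \<beta> lifts the map onto U, the elements 1 and \<beta>
    v act equally on u, so their difference annihilates u.\<close>
  define e where "e = \<one>\<^bsub>R\<^esub> \<ominus>\<^bsub>R\<^esub> \<beta> v"
  have e: "e \<in> ?I"
    using \<beta>_closed[OF v(1)] \<beta>_eq[OF v(1)] U(2)
    by (simp add: e_def annihilator_def a_minus_def U.smult_l_distr U.smult_minus_left \<delta>v
        U.smult_one U.M.r_neg)
  then obtain w where w: "w \<in> carrier V" "p w = e"
    using p(2) by (metis imageE)
  \<comment> \<open>For y in I, v y lies in the kernel of d 0, so the first summand is governed by
    the next term of the resolution, while the second lifts to V by sending y to w y.\<close>
  have split: "y = \<beta> (y \<odot>\<^bsub>P0\<^esub> v) \<oplus>\<^bsub>R\<^esub> e \<otimes>\<^bsub>R\<^esub> y" if "y \<in> carrier R" for y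
  proof -
    have "\<beta> (y \<odot>\<^bsub>P0\<^esub> v) = \<beta> v \<otimes>\<^bsub>R\<^esub> y"
      using right_module_hom_smult[OF \<beta> that v(1)] by (simp add: right_ideal_module_def)
    moreover have "y = \<beta> v \<otimes>\<^bsub>R\<^esub> y \<oplus>\<^bsub>R\<^esub> e \<otimes>\<^bsub>R\<^esub> y"
      unfolding e_def using \<beta>_closed[OF v(1)] that by algebra
    ultimately show ?thesis by simp
  qed
  have pw: "p (y \<odot>\<^bsub>V\<^esub> w) = e \<otimes>\<^bsub>R\<^esub> y" if "y \<in> carrier R" for y
    using right_module_hom_smult[OF p(1) that w(1)] w(2) by (simp add: right_ideal_module_def)
  have w_hom: "(\<lambda>y. y \<odot>\<^bsub>V\<^esub> w) \<in> right_module_hom R ?II V"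
    by (rule smult_right_module_hom[OF V(1) w(1) I_R])
  have v_hom: "(\<lambda>y. y \<odot>\<^bsub>P0\<^esub> v) \<in> right_module_hom R ?II P0"
    by (rule smult_right_module_hom[OF P0.right_module_axioms v(1) I_R])
  have d0_ker: "d 0 (y \<odot>\<^bsub>P0\<^esub> v) = \<zero>\<^bsub>?U\<^esub>" if "y \<in> ?I" for y
  proof -
    have "\<delta> (y \<odot>\<^bsub>P0\<^esub> v) = \<zero>\<^bsub>U\<^esub>"
      using that right_module_hom_smult[OF \<delta> _ v(1), of y] \<delta>v by (auto simp: annihilator_def)
    then show ?thesis
      using d0_\<delta>[of "y \<odot>\<^bsub>P0\<^esub> v"] that I_R v(1) by (auto simp: transport_module_def P0.smult_closed)
  qed
  consider "n = 0" | "n = 1"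
    using C(3) by linarith
  then show thesis
  proof cases
    case 1
    \<comment> \<open>In length zero the kernel is trivial: the first summand vanishes and w alone
      gives the section.\<close>
    then have inj0: "inj_on (d 0) (carrier P0)"
      using C(2) by (simp add: projective_resolution_def P0_def)
    show thesis
    proof (rule that[OF w_hom])
      fix y assume y: "y \<in> ?I"
      then have yR: "y \<in> carrier R" using I_R by auto
      have "d 0 (y \<odot>\<^bsub>P0\<^esub> v) = d 0 \<zero>\<^bsub>P0\<^esub>"
        using d0_ker[OF y] right_module_hom_zero[OF P0.right_module_axioms U'(1) d0] by simp
      then have "y \<odot>\<^bsub>P0\<^esub> v = \<zero>\<^bsub>P0\<^esub>"
        using inj0 yR v(1) by (auto dest!: inj_onD simp: P0.smult_closed)
      then have "\<beta> (y \<odot>\<^bsub>P0\<^esub> v) = \<zero>\<^bsub>R\<^esub>"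
        using right_module_hom_zero[OF P0.right_module_axioms right_module_regular[OF U.R.ring_axioms] \<beta>]
        by (simp add: right_ideal_module_def)
      then show "p (y \<odot>\<^bsub>V\<^esub> w) = y"
        using split[OF yR] pw[OF yR] yR e I_R by (auto simp: U.R.m_closed subset_iff)
    qed
  next
    case 2
    define P1 where "P1 = C 2"
    have P1: "projective_right_module R P1" and d1: "d 1 \<in> right_module_hom R P1 P0"
      and d1_img: "d 1 ` carrier P1 = a_kernel P0 ?U (d 0)" and d1_inj: "inj_on (d 1) (carrier P1)"
      using C 2 by (auto simp: projective_resolution_def P0_def P1_def numeral_2_eq_2)
    interpret P1: right_module R P1
      using P1 by (simp add: projective_right_module_def)
    define k where "k = (\<lambda>y. inv_into (carrier P1) (d 1) (y \<odot>\<^bsub>P0\<^esub> v))"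
    \<comment> \<open>The image of d 1, on which d 1 can be inverted; k sends y to the element of P1
      lying over v y.\<close>
    let ?K = "P0\<lparr>carrier := d 1 ` carrier P1\<rparr>"
    have v_img: "y \<odot>\<^bsub>P0\<^esub> v \<in> d 1 ` carrier P1" if "y \<in> ?I" for y
      using d0_ker[OF that] that I_R v(1) unfolding d1_img a_kernel_def'
      by (auto simp: P0.smult_closed)
    have "(\<lambda>y. y \<odot>\<^bsub>P0\<^esub> v) \<in> right_module_hom R ?II ?K"
      using v_hom v_img by (auto simp: right_module_hom_def right_ideal_module_def)
    then have k: "k \<in> right_module_hom R ?II P1"
      unfolding k_def
      by (rule right_module_hom_comp)
        (rule right_module_hom_inv[OF P1.right_module_axioms d1 d1_inj], auto)
    have d1_k: "d 1 (k y) = y \<odot>\<^bsub>P0\<^esub> v" if "y \<in> ?I" for y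
      using v_img[OF that] by (simp add: k_def f_inv_into_f)
    have "\<beta> (d 1 x) \<in> ?I" if "x \<in> carrier P1" for x
    proof -
      have x: "d 1 x \<in> carrier P0" "d 0 (d 1 x) = \<zero>\<^bsub>?U\<^esub>"
        using d1_img that unfolding a_kernel_def' by auto
      then have "\<delta> (d 1 x) = \<zero>\<^bsub>U\<^esub>"
        using \<eta> by (simp add: \<delta>_def transport_module_def)
      then show ?thesis
        using \<beta>_eq[OF x(1)] \<beta>_closed[OF x(1)] by (simp add: annihilator_def)
    qed
    then have "(\<lambda>x. \<beta> (d 1 x)) \<in> right_module_hom R P1 ?II"
      using right_module_hom_comp[OF d1 \<beta>]
      by (auto simp: right_module_hom_def right_ideal_module_def)
    \<comment> \<open>Projectivity of P1 lifts the first summand, seen as a map from P1 into I,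
      along p.\<close>
    then obtain g where g: "g \<in> right_module_hom R P1 V"
      and g_eq: "\<And>x. x \<in> carrier P1 \<Longrightarrow> p (g x) = \<beta> (d 1 x)"
      using projective_right_module_lift[OF P1 V right_module_annihilator[OF U(1,2)] inj(2) p(1)] p(2)
      by (auto simp: right_ideal_module_def)
    have gk: "(\<lambda>y. g (k y)) \<in> right_module_hom R ?II V"
      by (rule right_module_hom_comp[OF k g])
    show thesis
    proof (rule that[OF right_module_hom_plus[OF V(1) gk w_hom]])
      fix y assume y: "y \<in> ?I"
      then have yR: "y \<in> carrier R" and yI: "y \<in> carrier ?II"
        using I_R by (auto simp: right_ideal_module_def)
      have "p (g (k y) \<oplus>\<^bsub>V\<^esub> y \<odot>\<^bsub>V\<^esub> w) = p (g (k y)) \<oplus>\<^bsub>R\<^esub> p (y \<odot>\<^bsub>V\<^esub> w)"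
        using right_module_hom_add[OF p(1) right_module_hom_closed[OF gk yI]
            right_module_hom_closed[OF w_hom yI]] by (simp add: right_ideal_module_def)
      also have "\<dots> = y"
        using g_eq[OF right_module_hom_closed[OF k yI]] d1_k[OF y] pw[OF yR] split[OF yR] by simp
      finally show "p (g (k y) \<oplus>\<^bsub>V\<^esub> y \<odot>\<^bsub>V\<^esub> w) = y" .
    qed
  qed
qed

section \<open>Free modules and their evaluation maps\<close>

text \<open>A finitely supported function is coded by the list of its keys and the list of its
  values, and lists over an infinite type inject into that type. This places the free modules inside
  the universe.\<close>

lemma inj_poly_mapping_infinite:
  assumes "infinite (UNIV :: 'r::zero set)"
  shows "\<exists>\<iota> :: ('r \<Rightarrow>\<^sub>0 'r) \<Rightarrow> 'r. inj \<iota>"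
proof -
  obtain J :: "'r list \<Rightarrow> 'r" where "bij J"
    using lists_infinite_bij_betw_types[OF assms] by blast
  then have J: "J xs = J ys \<longleftrightarrow> xs = ys" for xs ys
    by (simp add: bij_is_inj inj_eq)
  \<comment> \<open>Any fixed enumeration of the support will do, provided that it depends on the
    support alone.\<close>
  define L where "L f = (SOME zs. set zs = Poly_Mapping.keys f)" for f :: "'r \<Rightarrow>\<^sub>0 'r"
  have L: "set (L f) = Poly_Mapping.keys f" for f
    unfolding L_def using finite_list[OF finite_keys[of f]] by (rule someI_ex)
  have "f = g" if eq: "L f = L g" "map (Poly_Mapping.lookup f) (L f) = map (Poly_Mapping.lookup g) (L g)" for f g
  proof (rule poly_mapping_eqI)
    fix z
    show "Poly_Mapping.lookup f z = Poly_Mapping.lookup g z"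
    proof (cases "z \<in> set (L f)")
      case True
      then show ?thesis using eq by simp
    next
      case False
      then have "z \<notin> Poly_Mapping.keys f" "z \<notin> Poly_Mapping.keys g"
        using L eq(1) by metis+
      then show ?thesis by (simp add: in_keys_iff)
    qed
  qed
  then have "inj (\<lambda>f. J [J (L f), J (map (Poly_Mapping.lookup f) (L f))])"
    unfolding inj_def J list.inject by blast
  then show ?thesis by blast
qed

context torsion_free_twisted_algebra
begin

abbreviation R where "R \<equiv> twisted_group_algebra A lam"

lemma R_simps:
  "carrier R = K" "monoid.mult R = (\<star>)" "monoid.one R = tone" "ring.zero R = 0" "ring.add R = (+)"
  by (simp_all add: twisted_group_algebra_def)

text \<open>The whole set I indexes the basis, so that evaluation is onto I without a choice of
  generators.\<close>

definition free_module :: "('a \<Rightarrow>\<^sub>0 'k) set \<Rightarrow> ('a \<Rightarrow>\<^sub>0 'k, ('a \<Rightarrow>\<^sub>0 'k) \<Rightarrow>\<^sub>0 ('a \<Rightarrow>\<^sub>0 'k)) module" where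
  "free_module I =
     \<lparr>carrier = {f. Poly_Mapping.keys f \<subseteq> I \<and> (\<forall>z. Poly_Mapping.lookup f z \<in> K)},
      monoid.mult = (\<lambda>_ _. undefined), monoid.one = undefined,
      ring.zero = 0, ring.add = (+),
      module.smult = (\<lambda>a f. Poly_Mapping.map (\<lambda>v. v \<star> a) f)\<rparr>"

lemma free_module_simps:
  "f \<in> carrier (free_module I) \<longleftrightarrow>
     Poly_Mapping.keys f \<subseteq> I \<and> (\<forall>z. Poly_Mapping.lookup f z \<in> K)"
  "ring.zero (free_module I) = 0" "ring.add (free_module I) = (+)"
  by (simp_all add: free_module_def)

lemma lookup_free_module_smult:
  "Poly_Mapping.lookup (a \<odot>\<^bsub>free_module I\<^esub> f) z = Poly_Mapping.lookup f z \<star> a"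
  by (simp add: free_module_def map.rep_eq when_def)

lemma free_module_smult_closed:
  assumes "a \<in> K" "f \<in> carrier (free_module I)"
  shows "a \<odot>\<^bsub>free_module I\<^esub> f \<in> carrier (free_module I)"
  unfolding free_module_simps
proof (intro conjI allI subsetI)
  fix z
  show "Poly_Mapping.lookup (a \<odot>\<^bsub>free_module I\<^esub> f) z \<in> K"
    unfolding lookup_free_module_smult using assms tmult_closed free_module_simps by blast
  assume "z \<in> Poly_Mapping.keys (a \<odot>\<^bsub>free_module I\<^esub> f)"
  then have "z \<in> Poly_Mapping.keys f"
    by (auto simp: in_keys_iff lookup_free_module_smult)
  then show "z \<in> I" using assms(2) by (auto simp: free_module_simps)
qed

lemma right_module_free: "right_module R (free_module I)"
proof (rule right_moduleI)
  show "ring R" by (rule ring_twisted_group_algebra[OF is_group cocycle])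
next
  fix f g assume "f \<in> carrier (free_module I)" "g \<in> carrier (free_module I)"
  then show "f \<oplus>\<^bsub>free_module I\<^esub> g \<in> carrier (free_module I)"
    using keys_add[of f g] K_add unfolding free_module_simps lookup_add by blast
next
  fix f assume "f \<in> carrier (free_module I)"
  then show "\<exists>g\<in>carrier (free_module I). g \<oplus>\<^bsub>free_module I\<^esub> f = \<zero>\<^bsub>free_module I\<^esub>"
    by (intro bexI[of _ "- f"]) (auto simp: free_module_simps)
next
  fix a b f assume *: "a \<in> carrier R" "b \<in> carrier R" "f \<in> carrier (free_module I)"
  then show "a \<odot>\<^bsub>free_module I\<^esub> f \<in> carrier (free_module I)"
    using free_module_smult_closed by (auto simp: R_simps)
  show "(a \<oplus>\<^bsub>R\<^esub> b) \<odot>\<^bsub>free_module I\<^esub> f = a \<odot>\<^bsub>free_module I\<^esub> f \<oplus>\<^bsub>free_module I\<^esub> b \<odot>\<^bsub>free_module I\<^esub> f"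
    by (rule poly_mapping_eqI)
      (simp add: free_module_simps R_simps lookup_add lookup_free_module_smult twisted_mult_add_right)
  show "(a \<otimes>\<^bsub>R\<^esub> b) \<odot>\<^bsub>free_module I\<^esub> f = b \<odot>\<^bsub>free_module I\<^esub> (a \<odot>\<^bsub>free_module I\<^esub> f)"
  proof (rule poly_mapping_eqI)
    fix z
    have "Poly_Mapping.lookup f z \<in> K" using * free_module_simps by blast
    then show "Poly_Mapping.lookup ((a \<otimes>\<^bsub>R\<^esub> b) \<odot>\<^bsub>free_module I\<^esub> f) z =
        Poly_Mapping.lookup (b \<odot>\<^bsub>free_module I\<^esub> (a \<odot>\<^bsub>free_module I\<^esub> f)) z"
      using * unfolding R_simps lookup_free_module_smult by (intro tmult_assoc[symmetric])
  qed
next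
  fix a f g assume "a \<in> carrier R" "f \<in> carrier (free_module I)" "g \<in> carrier (free_module I)"
  show "a \<odot>\<^bsub>free_module I\<^esub> (f \<oplus>\<^bsub>free_module I\<^esub> g) = a \<odot>\<^bsub>free_module I\<^esub> f \<oplus>\<^bsub>free_module I\<^esub> a \<odot>\<^bsub>free_module I\<^esub> g"
    by (rule poly_mapping_eqI)
      (simp add: free_module_simps R_simps lookup_add lookup_free_module_smult twisted_mult_add_left)
next
  fix f assume "f \<in> carrier (free_module I)"
  then have "Poly_Mapping.lookup f z \<in> K" for z using free_module_simps by blast
  then show "\<one>\<^bsub>R\<^esub> \<odot>\<^bsub>free_module I\<^esub> f = f"
    unfolding R_simps by (intro poly_mapping_eqI) (simp add: lookup_free_module_smult tmult_tone)
qed (auto simp: free_module_simps add_ac)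

text \<open>The canonical surjection from the free module on the set I onto I; the coordinates of a
  section of it form a dual basis.\<close>

definition free_module_eval :: "(('a \<Rightarrow>\<^sub>0 'k) \<Rightarrow>\<^sub>0 ('a \<Rightarrow>\<^sub>0 'k)) \<Rightarrow> ('a \<Rightarrow>\<^sub>0 'k)" where
  "free_module_eval f = (\<Sum>z\<in>Poly_Mapping.keys f. z \<star> Poly_Mapping.lookup f z)"

lemma free_module_eval_superset:
  "finite S \<Longrightarrow> Poly_Mapping.keys f \<subseteq> S \<Longrightarrow>
     free_module_eval f = (\<Sum>z\<in>S. z \<star> Poly_Mapping.lookup f z)"
  unfolding free_module_eval_def by (rule sum.mono_neutral_left) (auto simp: in_keys_iff)

lemma free_module_eval_add:
  "free_module_eval (f + g) = free_module_eval f + free_module_eval g"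
proof -
  let ?S = "Poly_Mapping.keys f \<union> Poly_Mapping.keys g"
  have "finite ?S" "Poly_Mapping.keys (f + g) \<subseteq> ?S" "Poly_Mapping.keys f \<subseteq> ?S" "Poly_Mapping.keys g \<subseteq> ?S"
    using keys_add[of f g] by auto
  then show ?thesis
    by (simp add: free_module_eval_superset[of ?S] lookup_add twisted_mult_add_right sum.distrib)
qed

lemma free_module_eval_smult:
  assumes "I \<subseteq> K" "a \<in> K" "f \<in> carrier (free_module I)"
  shows "free_module_eval (a \<odot>\<^bsub>free_module I\<^esub> f) = free_module_eval f \<star> a"
proof -
  have "Poly_Mapping.keys (a \<odot>\<^bsub>free_module I\<^esub> f) \<subseteq> Poly_Mapping.keys f"
    by (auto simp: in_keys_iff lookup_free_module_smult)
  then have "free_module_eval (a \<odot>\<^bsub>free_module I\<^esub> f) =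
      (\<Sum>z\<in>Poly_Mapping.keys f. z \<star> (Poly_Mapping.lookup f z \<star> a))"
    by (simp add: free_module_eval_superset[OF finite_keys] lookup_free_module_smult)
  also have "\<dots> = (\<Sum>z\<in>Poly_Mapping.keys f. z \<star> Poly_Mapping.lookup f z \<star> a)"
  proof (rule sum.cong[OF refl])
    fix z assume "z \<in> Poly_Mapping.keys f"
    then have "z \<in> K" "Poly_Mapping.lookup f z \<in> K" using assms free_module_simps by blast+
    then show "z \<star> (Poly_Mapping.lookup f z \<star> a) = z \<star> Poly_Mapping.lookup f z \<star> a"
      using tmult_assoc assms(2) by simp
  qed
  also have "\<dots> = free_module_eval f \<star> a"
    by (simp add: free_module_eval_def twisted_mult_sum_left)
  finally show ?thesis .
qed

section \<open>Annihilators over a twisted group algebra\<close>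

lemma annihilator_sum:
  assumes U: "right_module R U" "u \<in> carrier U"
    and "\<And>i. i \<in> S \<Longrightarrow> f i \<in> annihilator R U u"
  shows "sum f S \<in> annihilator R U u"
proof -
  interpret U: right_module R U by fact
  have "0 \<in> annihilator R U u"
    using U.smult_zero_left[OF U(2)] by (simp add: annihilator_def R_simps)
  moreover have "f + g \<in> annihilator R U u" if "f \<in> annihilator R U u" "g \<in> annihilator R U u" for f g
    using that U.smult_l_distr[of f g u] U(2) K_add[of f g] by (auto simp: annihilator_def R_simps)
  ultimately show ?thesis
    using assms(3) by (induction S rule: infinite_finite_induct) auto
qed

lemma annihilator_mult:
  assumes U: "right_module R U" "u \<in> carrier U" and "f \<in> annihilator R U u" "a \<in> K"
  shows "f \<star> a \<in> annihilator R U u"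
proof -
  interpret U: right_module R U by fact
  show ?thesis
    using U.smult_right_action[of f a u] assms U.smult_zero_right[of a] tmult_closed[of f a]
    by (auto simp: annihilator_def R_simps)
qed

lemma free_module_eval_annihilator:
  assumes U: "right_module R U" "u \<in> carrier U"
  defines "I \<equiv> annihilator R U u"
  shows "free_module_eval \<in> right_module_hom R (free_module I) (right_ideal_module R I)"
    and "free_module_eval ` carrier (free_module I) = I"
proof -
  have I: "I \<subseteq> K" by (auto simp: I_def annihilator_def R_simps)
  have closed: "free_module_eval f \<in> I" if "f \<in> carrier (free_module I)" for f
    unfolding free_module_eval_def I_def
  proof (rule annihilator_sum[OF U])
    fix z assume "z \<in> Poly_Mapping.keys f"
    then have "z \<in> annihilator R U u" "Poly_Mapping.lookup f z \<in> K"
      using that unfolding free_module_simps I_def by blast+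
    then show "z \<star> Poly_Mapping.lookup f z \<in> annihilator R U u"
      by (rule annihilator_mult[OF U])
  qed
  show "free_module_eval \<in> right_module_hom R (free_module I) (right_ideal_module R I)"
    using closed free_module_eval_add free_module_eval_smult[OF I]
    by (simp add: right_module_hom_def right_ideal_module_def free_module_simps R_simps)
  have "z \<in> free_module_eval ` carrier (free_module I)" if "z \<in> I" for z
  proof (rule image_eqI)
    show "z = free_module_eval (Poly_Mapping.single z tone)"
      using that I tmult_tone(2)[of z] by (auto simp: free_module_eval_superset[of "{z}"])
    show "Poly_Mapping.single z tone \<in> carrier (free_module I)"
      using that by (auto simp: free_module_simps lookup_single when_def)
  qed
  then show "free_module_eval ` carrier (free_module I) = I"
    using closed by blast
qed

text \<open>
  By \<open>annihilator_section\<close> the annihilator \<open>I\<close> is projective; the dual basis lemma then writes \<open>b\<close> as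
  \<open>\<Sum> z\<^sub>i f\<^sub>i b\<close> with \<open>z\<^sub>i \<in> I\<close> and homomorphisms \<open>f\<^sub>i\<close> from \<open>I\<close> to the algebra, so \<open>b = (\<Sum> z\<^sub>i c\<^sub>i) b\<close>,
  which puts the unit into \<open>I\<close>.
\<close>
lemma generator_eq_zero:
  assumes dim: "right_global_dimension TYPE('m) R \<le> 1" and inf: "infinite (UNIV :: 'a set)"
    and U: "right_module R U" "u \<in> carrier U" "(\<lambda>a. a \<odot>\<^bsub>U\<^esub> u) ` carrier R = carrier U"
    and b: "b \<in> annihilator R U u" "b \<noteq> 0"
    and hom: "\<And>f. f \<in> right_module_hom R (right_ideal_module R (annihilator R U u))
      (right_ideal_module R K) \<Longrightarrow> \<exists>c\<in>K. f b = c \<star> b"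
  shows "u = \<zero>\<^bsub>U\<^esub>"
proof -
  interpret U: right_module R U by fact
  let ?I = "annihilator R U u"
  have bK: "b \<in> K" using b(1) by (auto simp: annihilator_def R_simps)
  have "inj (\<lambda>a :: 'a. Poly_Mapping.single a (1 :: 'k))"
    by (rule injI) (metis lookup_single_eq lookup_single_not_eq zero_neq_one)
  then have "infinite (UNIV :: ('a \<Rightarrow>\<^sub>0 'k) set)"
    using inf finite_imageD infinite_super[OF subset_UNIV] by blast
  then obtain \<iota> :: "(('a \<Rightarrow>\<^sub>0 'k) \<Rightarrow>\<^sub>0 ('a \<Rightarrow>\<^sub>0 'k)) \<Rightarrow> ('a \<Rightarrow>\<^sub>0 'k)" where "inj \<iota>"
    using inj_poly_mapping_infinite by blast
  then have "inj_on (\<lambda>f. (\<iota> f, undefined :: 'm)) (carrier (free_module ?I))"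
    by (auto simp: inj_on_def)
  from annihilator_section[OF dim U right_module_free this free_module_eval_annihilator[OF U(1,2)]]
  obtain h where h: "h \<in> right_module_hom R (right_ideal_module R ?I) (free_module ?I)"
    and eval_h: "\<And>y. y \<in> ?I \<Longrightarrow> free_module_eval (h y) = y" by metis
  have h_closed: "h y \<in> carrier (free_module ?I)" if "y \<in> ?I" for y
    using right_module_hom_closed[OF h] that by (simp add: right_ideal_module_def)
  \<comment> \<open>Each coordinate of the section is a homomorphism from I to the algebra.\<close>
  have "\<exists>c\<in>K. Poly_Mapping.lookup (h b) z = c \<star> b" for z
  proof (rule hom)
    have "Poly_Mapping.lookup (h y) z \<in> K" if "y \<in> ?I" for y
      using h_closed[OF that] free_module_simps by blast
    then show "(\<lambda>y. Poly_Mapping.lookup (h y) z) \<in>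
        right_module_hom R (right_ideal_module R ?I) (right_ideal_module R K)"
      using h by (simp add: right_module_hom_def right_ideal_module_def free_module_simps
          lookup_add lookup_free_module_smult R_simps)
  qed
  then obtain c where c: "\<And>z. c z \<in> K" "\<And>z. Poly_Mapping.lookup (h b) z = c z \<star> b"
    by metis
  let ?Z = "Poly_Mapping.keys (h b)"
  have Z: "?Z \<subseteq> ?I" using h_closed[OF b(1)] free_module_simps by blast
  have ZK: "z \<in> K" if "z \<in> ?Z" for z using Z that by (auto simp: annihilator_def R_simps)
  have zc: "(\<Sum>z\<in>?Z. z \<star> c z) \<in> ?I"
    using Z c(1) by (intro annihilator_sum[OF U(1,2)] annihilator_mult[OF U(1,2)]) auto
  have "tone \<star> b = b" by (rule tmult_tone(1)[OF bK])
  also have "b = (\<Sum>z\<in>?Z. z \<star> (c z \<star> b))"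
    using eval_h[OF b(1)] by (simp add: free_module_eval_def c(2))
  also have "\<dots> = (\<Sum>z\<in>?Z. z \<star> c z) \<star> b"
    unfolding twisted_mult_sum_left
    by (intro sum.cong refl tmult_assoc[symmetric] ZK c(1) bK)
  finally have "tone = (\<Sum>z\<in>?Z. z \<star> c z)"
    using tmult_cancel_right[OF tone_closed _ bK b(2)] zc by (auto simp: annihilator_def R_simps)
  with zc have "tone \<odot>\<^bsub>U\<^esub> u = \<zero>\<^bsub>U\<^esub>" by (simp add: annihilator_def)
  then show ?thesis using U.smult_one[OF U(2)] by (simp add: R_simps)
qed

text \<open>Right linearity turns the common multiple p r = b z into (f p) r = (f b) z, so f b and f
  p are the numerators of one fraction with denominators b and p.\<close>

lemma hom_annihilator:
  fixes \<phi> :: "'a \<Rightarrow> int"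
  assumes \<phi>: "\<And>a b. a \<in> carrier A \<Longrightarrow> b \<in> carrier A \<Longrightarrow> \<phi> (a \<otimes> b) = \<phi> a + \<phi> b"
    and U: "right_module R U" "u \<in> carrier U"
    and b: "b \<in> annihilator R U u" "b \<noteq> 0" "\<And>a. a \<in> Poly_Mapping.keys b \<Longrightarrow> \<phi> a = 0"
    and p: "p \<in> annihilator R U u" "\<And>a. a \<in> Poly_Mapping.keys p \<Longrightarrow> \<phi> a \<le> d"
    and y: "y \<in> carrier A" "graded_component \<phi> d p = Poly_Mapping.single y 1"
    and f: "f \<in> right_module_hom R (right_ideal_module R (annihilator R U u)) (right_ideal_module R K)"
  shows "\<exists>c\<in>K. f b = c \<star> b"
proof -
  let ?I = "annihilator R U u"
  have K: "b \<in> K" "p \<in> K" using b(1) p(1) by (auto simp: annihilator_def R_simps)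
  obtain r z where rz: "r \<in> K" "z \<in> K" "r \<noteq> 0" "p \<star> r = b \<star> z"
    using right_Ore[OF K(2,1) b(2)] by metis
  have f_K: "f y \<in> K" if "y \<in> ?I" for y
    using right_module_hom_closed[OF f] that by (simp add: right_ideal_module_def)
  have f_mult: "f (y \<star> a) = f y \<star> a" if "y \<in> ?I" "a \<in> K" for y a
    using right_module_hom_smult[OF f] that by (simp add: right_ideal_module_def R_simps)
  have "f p \<star> r = f b \<star> z"
    using f_mult[OF p(1) rz(1)] f_mult[OF b(1) rz(2)] rz(4) by simp
  then show ?thesis
    using divides_of_monic_fraction[OF \<phi> K(1) b(2,3) K(2) p(2) y rz(1,3,2,4) f_K[OF b(1)] f_K[OF p(1)]]
    by blast
qed

text \<open>Writing the generators over F * B as translates of u, every element of U becomes u acted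
  on by some q whose degree is bounded by a fixed M, as F * B has degree zero. Applied to u times a
  basis element of degree above M, this gives a monic element that annihilates u.\<close>

lemma monic_annihilator:
  fixes \<phi> :: "'a \<Rightarrow> int"
  assumes \<phi>: "\<And>a b. a \<in> carrier A \<Longrightarrow> b \<in> carrier A \<Longrightarrow> \<phi> (a \<otimes> b) = \<phi> a + \<phi> b"
    and B: "B \<subseteq> carrier A" "\<And>a. a \<in> B \<Longrightarrow> \<phi> a = 0" and x: "x \<in> carrier A" "\<phi> x = 1"
    and U: "right_module R U" "u \<in> carrier U" "(\<lambda>a. a \<odot>\<^bsub>U\<^esub> u) ` carrier R = carrier U"
    and fg: "finitely_generated_right_module (twisted_group_algebra (A\<lparr>carrier := B\<rparr>) lam) U"
  obtains p d y where "p \<in> annihilator R U u" "\<And>a. a \<in> Poly_Mapping.keys p \<Longrightarrow> \<phi> a \<le> d"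
    "y \<in> carrier A" "graded_component \<phi> d p = Poly_Mapping.single y 1"
proof -
  interpret U: right_module R U by fact
  obtain S where S: "finite S" "S \<subseteq> carrier U"
    and gen: "\<And>v. v \<in> carrier U \<Longrightarrow>
      \<exists>c\<in>S \<rightarrow> {f. Poly_Mapping.keys f \<subseteq> B}. v = (\<Oplus>\<^bsub>U\<^esub>s\<in>S. c s \<odot>\<^bsub>U\<^esub> s)"
    using fg unfolding finitely_generated_right_module_def
    by (auto simp: twisted_group_algebra_def)
  have "\<exists>a\<in>K. a \<odot>\<^bsub>U\<^esub> u = s" if "s \<in> S" for s
    using U(3) S(2) that unfolding R_simps by (metis (no_types, lifting) imageE subsetD)
  then obtain \<alpha> where \<alpha>: "\<And>s. s \<in> S \<Longrightarrow> \<alpha> s \<in> K" "\<And>s. s \<in> S \<Longrightarrow> \<alpha> s \<odot>\<^bsub>U\<^esub> u = s"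
    by metis
  have "finite (\<phi> ` (\<Union>s\<in>S. Poly_Mapping.keys (\<alpha> s)))" using S(1) by simp
  then obtain M where M: "\<And>s a. s \<in> S \<Longrightarrow> a \<in> Poly_Mapping.keys (\<alpha> s) \<Longrightarrow> \<phi> a \<le> M"
    using finite_int_iff_bounded_le[of "\<phi> ` (\<Union>s\<in>S. Poly_Mapping.keys (\<alpha> s))"]
    by (metis (no_types, lifting) UN_I abs_le_D1 atMost_iff imageI subsetD)
  have \<phi>_pow: "\<phi> (x [^] n) = int n" for n :: nat
  proof (induction n)
    case 0
    show ?case using \<phi>[of \<one> \<one>] by simp
  next
    case (Suc n)
    then show ?case using \<phi>[of "x [^] n" x] x by simp
  qed
  \<comment> \<open>The least natural number above M, also when M is negative.\<close>
  define n where "n = nat (M + 1)"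
  define y where "y = x [^] n"
  have y: "y \<in> carrier A" "\<phi> y = int n" "M < int n"
    using x \<phi>_pow by (auto simp: y_def n_def)
  have y_K: "Poly_Mapping.single y 1 \<in> K" using y(1) by (rule K_single)
  obtain c where c: "c \<in> S \<rightarrow> {f. Poly_Mapping.keys f \<subseteq> B}"
    and yu: "Poly_Mapping.single y 1 \<odot>\<^bsub>U\<^esub> u = (\<Oplus>\<^bsub>U\<^esub>s\<in>S. c s \<odot>\<^bsub>U\<^esub> s)"
    using gen[of "Poly_Mapping.single y 1 \<odot>\<^bsub>U\<^esub> u"] U.smult_closed[OF _ U(2)] y_K
    unfolding R_simps by blast
  have c_B: "Poly_Mapping.keys (c s) \<subseteq> B" if "s \<in> S" for s
    using funcset_mem[OF c that] by simp
  then have c_K: "c s \<in> K" if "s \<in> S" for s using that B(1) by blast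
  have \<alpha>c: "\<alpha> s \<star> c s \<in> K" if "s \<in> S" for s
    by (rule tmult_closed[OF \<alpha>(1)[OF that] c_K[OF that]])
  define q where "q = (\<Sum>s\<in>S. \<alpha> s \<star> c s)"
  have q_K: "q \<in> K" unfolding q_def by (intro K_sum \<alpha>c)
  have "(\<Sum>s\<in>T. \<alpha> s \<star> c s) \<odot>\<^bsub>U\<^esub> u = (\<Oplus>\<^bsub>U\<^esub>s\<in>T. c s \<odot>\<^bsub>U\<^esub> s)" if "T \<subseteq> S" for T
    using finite_subset[OF that S(1)] that
  proof (induction T rule: finite_induct)
    case empty
    show ?case using U.smult_zero_left[OF U(2)] by (simp add: R_simps)
  next
    case (insert t T)
    have tc: "\<alpha> t \<star> c t \<in> carrier R"
      unfolding R_simps by (rule \<alpha>c) (use insert.prems in simp)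
    have Tc: "(\<Sum>s\<in>T. \<alpha> s \<star> c s) \<in> carrier R"
      unfolding R_simps by (intro K_sum \<alpha>c) (use insert.prems in auto)
    have "(\<Sum>s\<in>insert t T. \<alpha> s \<star> c s) \<odot>\<^bsub>U\<^esub> u =
        (\<alpha> t \<star> c t) \<odot>\<^bsub>U\<^esub> u \<oplus>\<^bsub>U\<^esub> (\<Sum>s\<in>T. \<alpha> s \<star> c s) \<odot>\<^bsub>U\<^esub> u"
      using U.smult_l_distr[OF tc Tc U(2)] insert.hyps by (simp add: R_simps(5))
    also have "(\<alpha> t \<star> c t) \<odot>\<^bsub>U\<^esub> u = c t \<odot>\<^bsub>U\<^esub> t"
      using U.smult_right_action[of "\<alpha> t" "c t" u] \<alpha>[of t] c_K[of t] U(2) insert.prems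
      unfolding R_simps by auto
    also have "(\<Sum>s\<in>T. \<alpha> s \<star> c s) \<odot>\<^bsub>U\<^esub> u = (\<Oplus>\<^bsub>U\<^esub>s\<in>T. c s \<odot>\<^bsub>U\<^esub> s)"
      using insert by simp
    also have "c t \<odot>\<^bsub>U\<^esub> t \<oplus>\<^bsub>U\<^esub> \<dots> = (\<Oplus>\<^bsub>U\<^esub>s\<in>insert t T. c s \<odot>\<^bsub>U\<^esub> s)"
    proof (rule U.M.finsum_insert[symmetric])
      have "c s \<odot>\<^bsub>U\<^esub> s \<in> carrier U" if "s \<in> S" for s
        using U.smult_closed[of "c s" s] c_K[OF that] S(2) that unfolding R_simps by blast
      then show "(\<lambda>s. c s \<odot>\<^bsub>U\<^esub> s) \<in> T \<rightarrow> carrier U" "c t \<odot>\<^bsub>U\<^esub> t \<in> carrier U"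
        using insert.prems by auto
    qed (use insert in auto)
    finally show ?case .
  qed
  then have qu: "q \<odot>\<^bsub>U\<^esub> u = Poly_Mapping.single y 1 \<odot>\<^bsub>U\<^esub> u"
    using yu by (simp add: q_def)
  have q_deg: "\<phi> a < int n" if a: "a \<in> Poly_Mapping.keys q" for a
  proof -
    obtain s where s: "s \<in> S" "a \<in> Poly_Mapping.keys (\<alpha> s \<star> c s)"
      using a keys_sum[of "\<lambda>s. \<alpha> s \<star> c s" S] unfolding q_def by blast
    then obtain a' b where ab: "a' \<in> Poly_Mapping.keys (\<alpha> s)" "b \<in> Poly_Mapping.keys (c s)" "\<phi> a = \<phi> a' + \<phi> b"
      using keys_tmult_degree[OF \<phi> \<alpha>(1) c_K] by metis
    have "b \<in> B" using ab(2) c_B[OF s(1)] by blast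
    then show ?thesis using ab(3) B(2) M[OF s(1) ab(1)] y(3) by simp
  qed
  define p where "p = Poly_Mapping.single y 1 - q"
  have p_K: "p \<in> K" unfolding p_def by (rule K_diff[OF y_K q_K])
  have sum: "p + q = Poly_Mapping.single y 1" by (simp add: p_def)
  have "p \<odot>\<^bsub>U\<^esub> u \<oplus>\<^bsub>U\<^esub> q \<odot>\<^bsub>U\<^esub> u = q \<odot>\<^bsub>U\<^esub> u"
    using U.smult_l_distr[of p q u] p_K q_K U(2) sum qu unfolding R_simps by simp
  \<comment> \<open>Here p + q and q act equally on u, so p acts as zero.\<close>
  then have "p \<odot>\<^bsub>U\<^esub> u = \<zero>\<^bsub>U\<^esub>"
    using U.smult_closed[OF _ U(2)] p_K q_K unfolding R_simps
    by (metis U.M.add.l_cancel_one' U.M.add.m_comm)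
  then have "p \<in> annihilator R U u" using p_K by (simp add: annihilator_def R_simps)
  moreover have "\<phi> a \<le> int n" if "a \<in> Poly_Mapping.keys p" for a
    using keys_diff[of "Poly_Mapping.single y (1 :: 'k)" q] that q_deg y(2)
    unfolding p_def by (fastforce dest: subsetD)
  moreover have "graded_component \<phi> (int n) p = Poly_Mapping.single y 1"
  proof -
    have "graded_component \<phi> (int n) q = 0" by (intro graded_component_eq_zero) (metis q_deg less_irrefl)
    then have "graded_component \<phi> (int n) p = graded_component \<phi> (int n) (p + q)"
      by (simp add: graded_component_add)
    also have "\<dots> = Poly_Mapping.single y 1"
      unfolding sum using y(2) by (intro graded_component_ident) (auto split: if_splits)
    finally show ?thesis .
  qed
  ultimately show thesis using that y(1) by blast
qed

end

section \<open>Simple modules and the contradiction\<close>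

lemma simple_right_module_cyclic:
  assumes "simple_right_module R U"
  obtains u where "u \<in> carrier U" "u \<noteq> \<zero>\<^bsub>U\<^esub>" "(\<lambda>a. a \<odot>\<^bsub>U\<^esub> u) ` carrier R = carrier U"
proof -
  interpret right_module R U
    using assms by (simp add: simple_right_module_def)
  obtain u where u: "u \<in> carrier U" "u \<noteq> \<zero>\<^bsub>U\<^esub>"
    using assms M.zero_closed unfolding simple_right_module_def by blast
  let ?N = "(\<lambda>a. a \<odot>\<^bsub>U\<^esub> u) ` carrier R"
  have "subgroup ?N (add_monoid U)"
  proof (rule M.add.subgroupI)
    show "?N \<subseteq> carrier U" "?N \<noteq> {}" using u smult_closed by auto
  next
    fix v assume "v \<in> ?N"
    then show "\<ominus>\<^bsub>U\<^esub> v \<in> ?N"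
      using u(1) by (auto simp: smult_minus_left[symmetric] intro!: imageI)
  next
    fix v w assume "v \<in> ?N" "w \<in> ?N"
    then show "v \<oplus>\<^bsub>U\<^esub> w \<in> ?N"
      using u(1) by (auto simp: smult_l_distr[symmetric] intro!: imageI)
  qed
  \<comment> \<open>The predicate \<open>submodule\<close> only asks for an additive subgroup closed
    under scalars, so it fits a right action as well.\<close>
  then have "submodule ?N R U"
    unfolding submodule_def submodule_axioms_def
    using u(1) by (auto simp: smult_right_action[symmetric] intro!: imageI)
  moreover have "u \<in> ?N" using smult_one[OF u(1)] R.one_closed by (metis imageI)
  ultimately have "?N = carrier U"
    using assms u(2) unfolding simple_right_module_def by blast
  with u show thesis by (rule that)
qed

theorem proposition2p9:
  fixes A :: "('a, 'c) monoid_scheme"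
    and B :: "'a set"
    and lam :: "'a \<Rightarrow> 'a \<Rightarrow> 'k::field"
    and U :: "('a \<Rightarrow>\<^sub>0 'k, 'u, 'e) module_scheme"
  assumes "comm_group A" and "finitely_generated_group A" and "torsion_free_group A"
    and "two_cocycle A lam"
    and "subgroup B A"
    and "cyclic_group (A Mod B)" and "infinite (carrier (A Mod B))"
    and "right_global_dimension TYPE('m) (twisted_group_algebra A lam) = 1"
    and "simple_right_module (twisted_group_algebra A lam) U"
    and "finitely_generated_right_module (twisted_group_algebra (A\<lparr>carrier := B\<rparr>) lam) U"
  shows "\<not> torsion_right_module (twisted_group_algebra (A\<lparr>carrier := B\<rparr>) lam) U"
proof
  assume tors: "torsion_right_module (twisted_group_algebra (A\<lparr>carrier := B\<rparr>) lam) U"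
  interpret comm_group A by fact
  interpret T: torsion_free_twisted_algebra A lam
    by unfold_locales (fact assms)+
  obtain \<phi> :: "'a \<Rightarrow> int" and x where
    *: "\<forall>a\<in>carrier A. \<forall>b\<in>carrier A. \<phi> (a \<otimes>\<^bsub>A\<^esub> b) = \<phi> a + \<phi> b"
    and B: "\<forall>a\<in>carrier A. \<phi> a = 0 \<longleftrightarrow> a \<in> B" and x: "x \<in> carrier A" "\<phi> x = 1"
    using infinite_cyclic_quotient_degree[OF assms(5-7)] by blast
  then have \<phi>: "\<phi> (a \<otimes>\<^bsub>A\<^esub> b) = \<phi> a + \<phi> b" if "a \<in> carrier A" "b \<in> carrier A" for a b
    using that by blast
  have BA: "B \<subseteq> carrier A" by (rule subgroup.subset[OF assms(5)])
  have B0: "\<phi> a = 0" if "a \<in> B" for a using B BA that by blast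
  \<comment> \<open>Infinitely many cosets require infinitely many group elements; this makes the
    universe large enough for the free module.\<close>
  have "infinite (UNIV :: 'a set)"
  proof
    assume "finite (UNIV :: 'a set)"
    then have "finite ((#>\<^bsub>A\<^esub>) B ` carrier A)" using finite_subset[OF subset_UNIV] by blast
    moreover have "carrier (A Mod B) = (#>\<^bsub>A\<^esub>) B ` carrier A"
      by (auto simp: FactGroup_def RCOSETS_def)
    ultimately show False using assms(7) by simp
  qed
  note inf = this
  have U: "right_module (twisted_group_algebra A lam) U"
    using assms(9) by (simp add: simple_right_module_def)
  obtain u where u: "u \<in> carrier U" "u \<noteq> \<zero>\<^bsub>U\<^esub>"
    "(\<lambda>a. a \<odot>\<^bsub>U\<^esub> u) ` carrier (twisted_group_algebra A lam) = carrier U"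
    using simple_right_module_cyclic[OF assms(9)] by metis
  obtain p d y where p: "p \<in> annihilator (twisted_group_algebra A lam) U u"
    "\<And>a. a \<in> Poly_Mapping.keys p \<Longrightarrow> \<phi> a \<le> d"
    "y \<in> carrier A" "graded_component \<phi> d p = Poly_Mapping.single y 1"
    using T.monic_annihilator[OF \<phi> BA B0 x U u(1,3) assms(10)] by blast
  \<comment> \<open>Torsion is applied to the generator u only.\<close>
  obtain b where "Poly_Mapping.keys b \<subseteq> B" "b \<noteq> 0" "b \<odot>\<^bsub>U\<^esub> u = \<zero>\<^bsub>U\<^esub>"
    using tors u(1) unfolding torsion_right_module_def by (auto simp: twisted_group_algebra_def)
  then have b: "b \<in> annihilator (twisted_group_algebra A lam) U u" "b \<noteq> 0"
    "\<And>a. a \<in> Poly_Mapping.keys b \<Longrightarrow> \<phi> a = 0"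
    using BA B0 by (auto simp: annihilator_def T.R_simps)
  have "right_global_dimension TYPE('m) (twisted_group_algebra A lam) \<le> 1"
    using assms(8) by simp
  from T.generator_eq_zero[OF this inf U u(1,3) b(1,2)]
  show False
    using T.hom_annihilator[OF \<phi> U u(1) b p] u(2) by blast
qed

end
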